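(* There exist Dirichlet series that belong to the Bloch space $\mathfrak{B}$ and to $\bigcap_{0<q<\infty}\mathcal{H}^q$ but not to $\mathrm{BMOA}$.
   Context: $\mathfrak{B}$ is the space of analytic functions $f$ in $\{\operatorname{Re}s>0\}$ with $\|f\|_{\mathfrak{B}}:=\sup_{\sigma>0,\,t\in\mathbb{R}}\sigma|f'(\sigma+it)|<\infty$. $\mathrm{BMOA}$ is the space of analytic functions $f$ in $\{\operatorname{Re}s>0\}$ satisfying $\sup_{\sigma>0}\int_{-\infty}^\infty\frac{|f(\sigma+it)|^2}{1+\sigma^2+t^2}\,dt<\infty$ and $\sup_I\frac1{|I|}\int_I\big|f(it)-\frac1{|I|}\int_If(i\tau)\,d\tau\big|\,dt<\infty$, where the supremum is over all finite intervals $I\subset\mathbb{R}$ and $f(it):=\lim_{\sigma\to0^+}f(\sigma+it)$ (which exists for a.e. $t$). For a Dirichlet series $f(s)=\sum_{n\ge1}a_nn^{-s}$, the Bohr lift is $\mathcal{B}f(z):=\sum_{n\ge1}a_nz^{\kappa(n)}$, where $\kappa(n)=(\kappa_1,\dots,\kappa_j,0,0,\dots)$ is the multi-index with $n=p_1^{\kappa_1}\cdots p_j^{\kappa_j}$, $p_j$ being the $j$th prime. For $0<q<\infty$, $\mathcal{H}^q$ is the space of Dirichlet series $f$ with $\mathcal{B}f\in H^q(\mathbb{T}^\infty)$, where $H^q(\mathbb{T}^\infty)$ is the closure of the analytic polynomials (in finitely many of the variables $z_1,z_2,\dots$) in $L^q(\mathbb{T}^\infty)$ with respect to Haar measure (the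 product of normalized Lebesgue measures) on the countable product $\mathbb{T}^\infty$ of unit circles. *)

theory Defs
  imports "HOL-Probability.Probability" "HOL-Complex_Analysis.Complex_Analysis"
    "HOL-Library.Poly_Mapping" "HOL-Library.Infinite_Set"
    "HOL-Computational_Algebra.Primes"
begin

definition right_half_plane :: "complex set" where
  "right_half_plane = {s. Re s > 0}"

definition Bloch :: "(complex \<Rightarrow> complex) set" where
  "Bloch = {f. f holomorphic_on right_half_plane \<and>
     bdd_above ((\<lambda>s. Re s * norm (deriv f s)) ` right_half_plane)}"

(* Meaningful only where the limit exists; under the square-integrability condition
   in BMOA below this is the case for almost every t, and the function of t is then
   Borel measurable and locally (square) integrable. *)
definition boundary_value :: "(complex \<Rightarrow> complex) \<Rightarrow> real \<Rightarrow> complex" where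
  "boundary_value f t = Lim (at_right 0) (\<lambda>\<sigma>. f (Complex \<sigma> t))"

definition interval_mean :: "(real \<Rightarrow> complex) \<Rightarrow> real \<Rightarrow> real \<Rightarrow> complex" where
  "interval_mean h a b = (LINT t:{a..b}|lborel. h t) /\<^sub>R (b - a)"

definition mean_oscillation :: "(real \<Rightarrow> complex) \<Rightarrow> real \<Rightarrow> real \<Rightarrow> ennreal" where
  "mean_oscillation h a b =
     (\<integral>\<^sup>+t\<in>{a..b}. ennreal (norm (h t - interval_mean h a b)) \<partial>lborel) / ennreal (b - a)"

definition BMOA :: "(complex \<Rightarrow> complex) set" where
  "BMOA = {f. f holomorphic_on right_half_plane \<and>
     (SUP \<sigma>\<in>{0<..}. \<integral>\<^sup>+t. ennreal ((norm (f (Complex \<sigma> t)))\<^sup>2 / (1 + \<sigma>\<^sup>2 + t\<^sup>2)) \<partial>lborel) < \<infinity> \<and>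
     (SUP (a, b)\<in>{(a, b). a < b}. mean_oscillation (boundary_value f) a b) < \<infinity>}"

(* The Dirichlet series with coefficients a(1), a(2), ... (a 0 is ignored) converges in
   some half-plane, and f agrees with its sum there. A function f that is moreover
   holomorphic in the right half-plane is thus the analytic continuation of the series. *)
definition has_dirichlet_series :: "(complex \<Rightarrow> complex) \<Rightarrow> (nat \<Rightarrow> complex) \<Rightarrow> bool" where
  "has_dirichlet_series f a \<longleftrightarrow> (\<exists>\<sigma>\<^sub>0\<ge>0. \<forall>s. Re s > \<sigma>\<^sub>0 \<longrightarrow>
     (\<lambda>n. a (Suc n) * of_nat (Suc n) powr (- s)) sums f s)"

(* Primes, and the variables z_j below, are indexed from 0. *)
definition nth_prime :: "nat \<Rightarrow> nat" where
  "nth_prime j = enumerate {p. prime p} j"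

lift_definition kappa :: "nat \<Rightarrow> (nat \<Rightarrow>\<^sub>0 nat)" is
  "\<lambda>n j. multiplicity (nth_prime j) n"
proof -
  fix n :: nat
  have "j \<le> n" if "multiplicity (nth_prime j) n \<noteq> 0" for j
  proof -
    have "n \<noteq> 0" using that by (metis multiplicity_zero)
    moreover have "nth_prime j dvd n"
      using that not_dvd_imp_multiplicity_0[of "nth_prime j" n] by argo
    ultimately have "nth_prime j \<le> n" by (simp add: dvd_imp_le)
    moreover have "j \<le> nth_prime j"
      unfolding nth_prime_def by (rule le_enumerate[OF primes_infinite])
    ultimately show ?thesis by (rule order.trans[rotated])
  qed
  then show "finite {j. multiplicity (nth_prime j) n \<noteq> 0}"
    by (intro finite_subset[OF _ finite_atMost[of n]]) blast
qed

definition monomial_eval :: "(nat \<Rightarrow>\<^sub>0 nat) \<Rightarrow> (nat \<Rightarrow> complex) \<Rightarrow> complex" where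
  "monomial_eval \<alpha> z = (\<Prod>j\<in>Poly_Mapping.keys \<alpha>. z j ^ Poly_Mapping.lookup \<alpha> j)"

(* An analytic polynomial in finitely many of the variables z_0, z_1, ... is given by its
   finitely many nonzero coefficients, indexed by multi-indices. *)
type_synonym analytic_poly = "(nat \<Rightarrow>\<^sub>0 nat) \<Rightarrow>\<^sub>0 complex"

definition analytic_poly_eval :: "analytic_poly \<Rightarrow> (nat \<Rightarrow> complex) \<Rightarrow> complex" where
  "analytic_poly_eval P z =
     (\<Sum>\<alpha>\<in>Poly_Mapping.keys P. Poly_Mapping.lookup P \<alpha> * monomial_eval \<alpha> z)"

definition circle_measure :: "complex measure" where
  "circle_measure = distr (uniform_measure lborel {0..<2 * pi})
     (restrict_space borel (sphere 0 1)) cis"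

definition polytorus :: "(nat \<Rightarrow> complex) measure" where
  "polytorus = (\<Pi>\<^sub>M j\<in>UNIV. circle_measure)"

definition Lq_torus :: "real \<Rightarrow> ((nat \<Rightarrow> complex) \<Rightarrow> complex) set" where
  "Lq_torus q = {g \<in> borel_measurable polytorus.
     integrable polytorus (\<lambda>z. norm (g z) powr q)}"

definition tendsto_Lq :: "real \<Rightarrow> (nat \<Rightarrow> analytic_poly) \<Rightarrow> ((nat \<Rightarrow> complex) \<Rightarrow> complex) \<Rightarrow> bool" where
  "tendsto_Lq q P g \<longleftrightarrow>
     (\<lambda>k. LINT z|polytorus. norm (analytic_poly_eval (P k) z - g z) powr q) \<longlonglongrightarrow> 0"

(* The closure of the analytic polynomials in L^q (functions, not a.e.-classes). *)
definition Hq_torus :: "real \<Rightarrow> ((nat \<Rightarrow> complex) \<Rightarrow> complex) set" where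
  "Hq_torus q = {g \<in> Lq_torus q. \<exists>P. tendsto_Lq q P g}"

(* g in Hq_torus q has the power series with coefficient c(alpha) at z^alpha.
   For q >= 1 these are the Fourier coefficients of g. For q < 1 the function g need not be
   integrable; for every q > 0, however, each coefficient functional is continuous on the
   analytic polynomials in the L^q (quasi-)norm and so extends to the closure, and the
   coefficients of g are the limits of those of any polynomials converging to g. *)
definition has_torus_coeffs ::
  "real \<Rightarrow> ((nat \<Rightarrow> complex) \<Rightarrow> complex) \<Rightarrow> ((nat \<Rightarrow>\<^sub>0 nat) \<Rightarrow> complex) \<Rightarrow> bool" where
  "has_torus_coeffs q g c \<longleftrightarrow> (\<exists>P. tendsto_Lq q P g \<and>
     (\<forall>\<alpha>. (\<lambda>k. Poly_Mapping.lookup (P k) \<alpha>) \<longlonglongrightarrow> c \<alpha>))"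

(* Coefficients of the Bohr lift: a(n) at z^kappa(n) for n >= 1. Since kappa is a bijection
   from the positive integers to the multi-indices, the sum has exactly one term. *)
definition bohr_lift :: "(nat \<Rightarrow> complex) \<Rightarrow> (nat \<Rightarrow>\<^sub>0 nat) \<Rightarrow> complex" where
  "bohr_lift a \<alpha> = (\<Sum>n | n \<ge> 1 \<and> kappa n = \<alpha>. a n)"

(* Dirichlet series are represented by their coefficient sequences. *)
definition Hq_dirichlet :: "real \<Rightarrow> (nat \<Rightarrow> complex) set" where
  "Hq_dirichlet q = {a. \<exists>g\<in>Hq_torus q. has_torus_coeffs q g (bohr_lift a)}"

end

(* The series is f(s) = sum_k 3^(-64^k s) ((1 + 2^(-s))/2)^(2^k). The factors (1 + 2^(-s))/2 have modulus
   at most 1 in the half-plane, so f is a sum of bounded blocks with lacunary frequencies and hence a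
   Bloch function. On the polytorus |(1 + z)/2| < 1 off z = 1, so the lifted series is dominated by
   sum_k |(1 + z)/2|^(2^k), which has only a logarithmic singularity and lies in every L^q.
   Near t = 0, however, on an interval of length 8^(-N) the blocks k = N, ..., 2N - 1 are practically
   the pure oscillations exp(-i mu_k t), mu_k = 64^k ln 3, and testing f against the bounded Riesz
   product of the factors 1 + (i / sqrt N) cos(mu_k t) shows that its mean oscillation there is at
   least of order sqrt N. *)
theory Submission
  imports Defs
begin

subsection \<open>Riesz products on an interval\<close>

text \<open>The sum of the 3^(-64^k s) alone would be a Bloch function outside BMOA, but its lift
  has infinitely many coefficients 1 and is not even in H^2. The damping factor must therefore be
  nearly 1 for small t and yet small almost everywhere on the torus; it uses the independent
  variable 2^(-s), and its exponent 2^k sets the width, about 2^(-k), within which block k is still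
  undamped. The constants 2, 8 and 64 = 8 * 8 are balanced against each other: for t of order 8^(-N)
  the damping factors of all blocks below 2N differ from 1 by at most 2^(-N), while the interval
  holds of order 8^N periods of the slowest tested wave, enough to absorb the errors of order N^2
  2^N of the Riesz product. The test interval is [d, 2d] with d = 8^(-N) and not [0, d], because
  every block equals 1 at s = 0 and the series diverges there. The cosines carry the factor i
  because, with c = 1 / sqrt N, the moduli then multiply to a bounded number, while the N resonances
  still add up to N c / 2 = sqrt N / 2.\<close>

definition riesz_product :: "real \<Rightarrow> (nat \<Rightarrow> real) \<Rightarrow> nat \<Rightarrow> real \<Rightarrow> complex" where
  "riesz_product c \<mu> n t = (\<Prod>i<n. 1 + \<i> * of_real (c * cos (\<mu> i * t)))"

text \<open>Fourier transform, at -\<nu>, of the Riesz product cut off to an interval. With the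
  number of factors and the frequency as arguments it obeys a recursion, which replaces the
  expansion into 3^n exponentials.\<close>

definition riesz_transform ::
  "real \<Rightarrow> (nat \<Rightarrow> real) \<Rightarrow> real \<Rightarrow> real \<Rightarrow> nat \<Rightarrow> real \<Rightarrow> complex" where
  "riesz_transform c \<mu> a b n \<nu> = integral {a..b} (\<lambda>t. cis (\<nu> * t) * riesz_product c \<mu> n t)"

lemma continuous_on_riesz_product [continuous_intros]:
  "continuous_on A (riesz_product c \<mu> n)"
  unfolding riesz_product_def by (intro continuous_intros)

text \<open>An imaginary perturbation enters the modulus only to second order: each factor costs at
  most exp (c^2 / 2), whereas real factors 1 + c cos could reach 1 + c each.\<close>

lemma norm_riesz_product_le:
  assumes "real n * c\<^sup>2 \<le> 1"
  shows "norm (riesz_product c \<mu> n t) \<le> 2"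
proof -
  have le: "norm (1 + \<i> * of_real (c * cos (\<mu> i * t)) :: complex) \<le> exp (c\<^sup>2 / 2)" for i
  proof -
    have "(norm (1 + \<i> * of_real (c * cos (\<mu> i * t)) :: complex))\<^sup>2 = 1 + c\<^sup>2 * (cos (\<mu> i * t))\<^sup>2"
      by (simp add: cmod_power2 power_mult_distrib)
    also have "\<dots> \<le> 1 + c\<^sup>2 * 1"
      by (intro add_left_mono mult_left_mono) (auto simp: abs_square_le_1)
    also have "\<dots> \<le> exp (c\<^sup>2)"
      using exp_ge_add_one_self[of "c\<^sup>2"] by simp
    also have "\<dots> = (exp (c\<^sup>2 / 2))\<^sup>2"
      by (simp add: power2_eq_square flip: exp_add)
    finally show ?thesis
      by (rule power2_le_imp_le) simp
  qed
  have "norm (riesz_product c \<mu> n t) \<le> (\<Prod>i<n. exp (c\<^sup>2 / 2))"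
    unfolding riesz_product_def prod_norm[symmetric] by (intro prod_mono conjI le norm_ge_zero)
  also have "\<dots> = exp (real n * c\<^sup>2 / 2)"
    by (simp flip: exp_of_nat_mult)
  also have "\<dots> \<le> exp (1 / 2)"
    using assms by simp
  also have "\<dots> \<le> 2"
    using exp_bound_half[of "1/2 :: real"] by simp
  finally show ?thesis .
qed

lemma norm_integral_cis_le:
  assumes "a \<le> b" "\<nu> \<noteq> 0"
  shows "norm (integral {a..b} (\<lambda>t. cis (\<nu> * t))) \<le> 2 / \<bar>\<nu>\<bar>"
proof -
  have "((\<lambda>t. cis (\<nu> * t)) has_integral (cis (\<nu> * b) / (\<i> * \<nu>) - cis (\<nu> * a) / (\<i> * \<nu>))) {a..b}"
  proof (rule fundamental_theorem_of_calculus[OF assms(1)])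
    fix t
    have "((\<lambda>t. exp (\<i> * of_real \<nu> * of_real t) / (\<i> * \<nu>)) has_vector_derivative
        exp (\<i> * of_real \<nu> * of_real t)) (at t within {a..b})"
      using assms(2)
      by (auto intro!: derivative_eq_intros has_vector_derivative_real_field simp: field_simps)
    then show "((\<lambda>t. cis (\<nu> * t) / (\<i> * \<nu>)) has_vector_derivative cis (\<nu> * t)) (at t within {a..b})"
      by (simp add: cis_conv_exp mult.assoc)
  qed
  then have "integral {a..b} (\<lambda>t. cis (\<nu> * t)) = (cis (\<nu> * b) - cis (\<nu> * a)) / (\<i> * \<nu>)"
    by (simp add: integral_unique diff_divide_distrib)
  also have "norm \<dots> \<le> 2 / \<bar>\<nu>\<bar>"
    using norm_triangle_ineq4[of "cis (\<nu> * b)" "cis (\<nu> * a)"]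
    by (simp add: norm_divide norm_mult divide_right_mono)
  finally show ?thesis .
qed

lemma riesz_transform_0: "riesz_transform c \<mu> a b 0 \<nu> = integral {a..b} (\<lambda>t. cis (\<nu> * t))"
  by (simp add: riesz_transform_def riesz_product_def)

lemma riesz_transform_Suc:
  "riesz_transform c \<mu> a b (Suc n) \<nu> = riesz_transform c \<mu> a b n \<nu> +
     \<i> * of_real (c / 2) * (riesz_transform c \<mu> a b n (\<nu> + \<mu> n) + riesz_transform c \<mu> a b n (\<nu> - \<mu> n))"
proof -
  let ?g = "\<lambda>\<nu> t. cis (\<nu> * t) * riesz_product c \<mu> n t"
  have int: "?g \<nu> integrable_on {a..b}" for \<nu>
    by (intro integrable_continuous_real continuous_intros)
  have "cis (\<nu> * t) * riesz_product c \<mu> (Suc n) t =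
      ?g \<nu> t + \<i> * of_real (c / 2) * (?g (\<nu> + \<mu> n) t + ?g (\<nu> - \<mu> n) t)" for t
  proof -
    have "cis ((\<nu> + \<mu> n) * t) + cis ((\<nu> - \<mu> n) * t) = 2 * of_real (cos (\<mu> n * t)) * cis (\<nu> * t)"
      by (simp add: complex_eq_iff cos_add sin_add cos_diff sin_diff algebra_simps)
    then have "?g (\<nu> + \<mu> n) t + ?g (\<nu> - \<mu> n) t =
        2 * of_real (cos (\<mu> n * t)) * cis (\<nu> * t) * riesz_product c \<mu> n t"
      by (simp flip: distrib_right)
    moreover have "riesz_product c \<mu> (Suc n) t =
        riesz_product c \<mu> n t * (1 + \<i> * of_real (c * cos (\<mu> n * t)))"
      by (simp add: riesz_product_def)
    ultimately show ?thesis
      by (simp add: algebra_simps)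
  qed
  then have "riesz_transform c \<mu> a b (Suc n) \<nu> =
      integral {a..b} (\<lambda>t. ?g \<nu> t + \<i> * of_real (c / 2) * (?g (\<nu> + \<mu> n) t + ?g (\<nu> - \<mu> n) t))"
    by (simp add: riesz_transform_def)
  also have "\<dots> = integral {a..b} (?g \<nu>) +
      integral {a..b} (\<lambda>t. \<i> * of_real (c / 2) * (?g (\<nu> + \<mu> n) t + ?g (\<nu> - \<mu> n) t))"
    by (intro Henstock_Kurzweil_Integration.integral_add int integrable_on_mult_right
        Henstock_Kurzweil_Integration.integrable_add)
  also have "integral {a..b} (\<lambda>t. \<i> * of_real (c / 2) * (?g (\<nu> + \<mu> n) t + ?g (\<nu> - \<mu> n) t)) =
      \<i> * of_real (c / 2) * (integral {a..b} (?g (\<nu> + \<mu> n)) + integral {a..b} (?g (\<nu> - \<mu> n)))"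
    by (subst Henstock_Kurzweil_Integration.integral_add[OF int int, symmetric])
      (rule integral_mult_right)
  finally show ?thesis
    by (simp add: riesz_transform_def)
qed

text \<open>The product only contains frequencies of modulus at most the sum of the \<mu> i, with
  coefficients of total modulus at most (1 + c)^n. If \<nu> exceeds that sum, no term can cancel it,
  and each one integrates to at most 2 over the remaining distance from 0.\<close>

lemma norm_riesz_transform_le:
  assumes "a \<le> b" "0 \<le> c" "\<And>i. i < n \<Longrightarrow> 0 \<le> \<mu> i" "(\<Sum>i<n. \<mu> i) < \<bar>\<nu>\<bar>"
  shows "norm (riesz_transform c \<mu> a b n \<nu>) \<le> (1 + c) ^ n * (2 / (\<bar>\<nu>\<bar> - (\<Sum>i<n. \<mu> i)))"
  using assms(3,4)
proof (induction n arbitrary: \<nu>)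
  case 0
  then show ?case using norm_integral_cis_le[of a b \<nu>] assms(1) by (simp add: riesz_transform_0)
next
  case (Suc n)
  let ?J = "riesz_transform c \<mu> a b n" and ?S = "\<Sum>i<n. \<mu> i"
  \<comment> \<open>The sum already includes \<open>\<mu> n\<close>, so that one bound covers \<nu>
    and both shifted frequencies.\<close>
  define B where "B = (1 + c) ^ n * (2 / (\<bar>\<nu>\<bar> - (\<Sum>i<Suc n. \<mu> i)))"
  have mu: "0 \<le> \<mu> n" using Suc.prems(1)[of n] by simp
  have bd: "norm (?J x) \<le> B" if "\<bar>\<nu>\<bar> - \<mu> n \<le> \<bar>x\<bar>" for x
  proof -
    have "norm (?J x) \<le> (1 + c) ^ n * (2 / (\<bar>x\<bar> - ?S))"
      using Suc.prems that by (intro Suc.IH) auto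
    also have "\<dots> \<le> B"
      unfolding B_def using that Suc.prems assms(2)
      by (intro mult_left_mono divide_left_mono mult_pos_pos) auto
    finally show ?thesis .
  qed
  have "norm (riesz_transform c \<mu> a b (Suc n) \<nu>) \<le>
      norm (?J \<nu>) + norm (\<i> * of_real (c / 2) * (?J (\<nu> + \<mu> n) + ?J (\<nu> - \<mu> n)))"
    unfolding riesz_transform_Suc by (rule norm_triangle_ineq)
  also have "\<dots> = norm (?J \<nu>) + c / 2 * norm (?J (\<nu> + \<mu> n) + ?J (\<nu> - \<mu> n))"
    using assms(2) by (simp add: norm_mult)
  also have "\<dots> \<le> B + c / 2 * (B + B)"
    using assms(2) mu
    by (intro add_mono mult_left_mono order.trans[OF norm_triangle_ineq] bd) auto
  also have "\<dots> = (1 + c) ^ Suc n * (2 / (\<bar>\<nu>\<bar> - (\<Sum>i<Suc n. \<mu> i)))"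
    by (simp add: B_def algebra_simps add_divide_distrib)
  finally show ?case .
qed

text \<open>Factor k moves the frequency to \<nu> + \<mu> k or \<nu> - \<mu> k, and the gap
  condition says that the factors below k cannot bring it back within d of 0. Hence factors from m
  on hardly matter, even if the transform at \<nu> itself is large.\<close>

lemma norm_riesz_transform_diff_le:
  assumes ab: "a \<le> b" and c: "0 \<le> c" and "m \<le> n" and d: "0 < d"
    and mu: "\<And>i. i < n \<Longrightarrow> 0 \<le> \<mu> i"
    and gap: "\<And>k. m \<le> k \<Longrightarrow> k < n \<Longrightarrow> d \<le> \<mu> k - \<bar>\<nu>\<bar> - (\<Sum>i<k. \<mu> i)"
  shows "norm (riesz_transform c \<mu> a b n \<nu> - riesz_transform c \<mu> a b m \<nu>)
    \<le> real (n - m) * c * ((1 + c) ^ n * (2 / d))"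
  using \<open>m \<le> n\<close> mu gap
proof (induction n rule: dec_induct)
  case base
  then show ?case by simp
next
  case (step n)
  let ?J = "riesz_transform c \<mu> a b"
  define B where "B = (1 + c) ^ n * (2 / d)"
  have B0: "0 \<le> B" using c d by (simp add: B_def)
  have BS: "B \<le> (1 + c) ^ Suc n * (2 / d)"
    unfolding B_def using c d by (intro mult_right_mono power_increasing) auto
  have bd: "norm (?J n x) \<le> B" if "\<mu> n - \<bar>\<nu>\<bar> \<le> \<bar>x\<bar>" for x
  proof -
    have *: "d \<le> \<bar>x\<bar> - (\<Sum>i<n. \<mu> i)" using step.prems(2)[of n] step.hyps that by simp
    have "norm (?J n x) \<le> (1 + c) ^ n * (2 / (\<bar>x\<bar> - (\<Sum>i<n. \<mu> i)))"
      using step.prems * d by (intro norm_riesz_transform_le ab c) auto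
    also have "\<dots> \<le> B"
      unfolding B_def using * d c by (intro mult_left_mono divide_left_mono mult_pos_pos) auto
    finally show ?thesis .
  qed
  have "norm (?J (Suc n) \<nu> - ?J m \<nu>) \<le> norm (?J n \<nu> - ?J m \<nu>) +
      norm (\<i> * of_real (c / 2) * (?J n (\<nu> + \<mu> n) + ?J n (\<nu> - \<mu> n)))"
    unfolding riesz_transform_Suc by (rule order.trans[OF _ norm_triangle_ineq]) (simp add: algebra_simps)
  also have "\<dots> = norm (?J n \<nu> - ?J m \<nu>) + c / 2 * norm (?J n (\<nu> + \<mu> n) + ?J n (\<nu> - \<mu> n))"
    using c by (simp add: norm_mult)
  also have "\<dots> \<le> real (n - m) * c * B + c / 2 * (B + B)"
    unfolding B_def[symmetric] using c
    by (intro add_mono mult_left_mono order.trans[OF norm_triangle_ineq] bd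
        order.trans[OF step.IH[OF step.prems]]) (auto simp: B_def)
  also have "\<dots> = real (Suc n - m) * c * B"
    using step.hyps by (simp add: Suc_diff_le algebra_simps)
  also have "\<dots> \<le> real (Suc n - m) * c * ((1 + c) ^ Suc n * (2 / d))"
    using BS c by (intro mult_left_mono) auto
  finally show ?case .
qed

lemma lacunary_le:
  fixes \<mu> :: "nat \<Rightarrow> real"
  assumes "\<And>i. 0 \<le> \<mu> i" "\<And>k. 4 * (\<Sum>i<k. \<mu> i) \<le> \<mu> k" "j \<le> k"
  shows "\<mu> j \<le> \<mu> k"
proof (cases "j = k")
  case False
  with assms(3) have "j < k" by simp
  then have "\<mu> j \<le> (\<Sum>i<k. \<mu> i)"
    using assms(1) by (intro member_le_sum) auto
  moreover have "0 \<le> (\<Sum>i<k. \<mu> i)" by (intro sum_nonneg assms)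
  ultimately show ?thesis using assms(2)[of k] by linarith
qed simp

text \<open>Only the constant term 1 of the product acts on a frequency far below all \<mu> i.
  Subtracting it leaves a small error, so the Riesz product minus 1 is nearly orthogonal to slow
  waves and to constants.\<close>

lemma riesz_transform_low_frequency:
  assumes ab: "a \<le> b" and c: "0 \<le> c" "c \<le> 1"
    and mu: "\<And>i. 0 < \<mu> i" and lac: "\<And>k. 4 * (\<Sum>i<k. \<mu> i) \<le> \<mu> k"
    and nu: "4 * \<bar>\<nu>\<bar> \<le> \<mu> 0"
  shows "norm (riesz_transform c \<mu> a b n \<nu> - integral {a..b} (\<lambda>t. cis (\<nu> * t)))
    \<le> real n * (4 * (1 + c) ^ n / \<mu> 0)"
proof -
  have "norm (riesz_transform c \<mu> a b n \<nu> - riesz_transform c \<mu> a b 0 \<nu>)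
      \<le> real (n - 0) * c * ((1 + c) ^ n * (2 / (\<mu> 0 / 2)))"
  proof (rule norm_riesz_transform_diff_le[OF ab c(1)])
    fix k
    have "\<mu> 0 \<le> \<mu> k" using mu lac by (intro lacunary_le) (auto intro: less_imp_le)
    then show "\<mu> 0 / 2 \<le> \<mu> k - \<bar>\<nu>\<bar> - (\<Sum>i<k. \<mu> i)"
      using lac[of k] nu by linarith
  qed (use mu in \<open>auto intro: less_imp_le\<close>)
  also have "\<dots> \<le> real n * 1 * ((1 + c) ^ n * (2 / (\<mu> 0 / 2)))"
    using c mu[of 0] by (intro mult_right_mono mult_left_mono) (auto intro: less_imp_le mult_left_le)
  finally show ?thesis by (simp add: riesz_transform_0 mult.commute)
qed

text \<open>Factors above j are negligible by the gap estimate. Factor j either leaves the frequency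
  at -\<mu> j, or moves it to -2 \<mu> j, both out of reach of the factors below j, or moves it to
  0, where the transform is close to the length of the interval. This last case carries the
  coefficient i c / 2.\<close>

lemma riesz_transform_resonant:
  assumes ab: "a \<le> b" and c: "0 \<le> c" "c \<le> 1"
    and mu: "\<And>i. 0 < \<mu> i" and lac: "\<And>k. 4 * (\<Sum>i<k. \<mu> i) \<le> \<mu> k" and j: "j < n"
  shows "norm (riesz_transform c \<mu> a b n (- \<mu> j) - \<i> * of_real (c / 2 * (b - a)))
    \<le> real (2 * n + 2) * (4 * (1 + c) ^ n / \<mu> 0)"
proof -
  let ?J = "riesz_transform c \<mu> a b"
  define E where "E = 4 * (1 + c) ^ n / \<mu> 0"
  have E0: "0 \<le> E" using c mu[of 0] by (simp add: E_def)
  have mono: "\<mu> i \<le> \<mu> k" if "i \<le> k" for i k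
    using that mu lac by (intro lacunary_le) (auto intro: less_imp_le)
  have pow: "(1 + c) ^ k \<le> (1 + c) ^ n" if "k \<le> n" for k
    using that c by (intro power_increasing) auto
  have 1: "norm (?J n (- \<mu> j) - ?J (Suc j) (- \<mu> j)) \<le> real n * E"
  proof -
    have "norm (?J n (- \<mu> j) - ?J (Suc j) (- \<mu> j))
        \<le> real (n - Suc j) * c * ((1 + c) ^ n * (2 / (\<mu> 0 / 2)))"
    proof (rule norm_riesz_transform_diff_le[OF ab c(1)])
      \<comment> \<open>Here \<open>\<mu> j\<close> is one of the terms of the sum below k, so each
        of the two subtracted quantities is at most a quarter of \<open>\<mu> k\<close>.\<close>
      fix k assume "Suc j \<le> k"
      then have "\<mu> j \<le> (\<Sum>i<k. \<mu> i)"
        using mu by (intro member_le_sum) (auto intro: less_imp_le)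
      then show "\<mu> 0 / 2 \<le> \<mu> k - \<bar>- \<mu> j\<bar> - (\<Sum>i<k. \<mu> i)"
        using lac[of k] mono[of 0 k] mu[of j] by simp
    qed (use mu j in \<open>auto intro: less_imp_le\<close>)
    also have "\<dots> = real (n - Suc j) * c * E" by (simp add: E_def)
    also have "\<dots> \<le> real n * 1 * E"
      using c E0 by (intro mult_mono) auto
    finally show ?thesis by simp
  qed
  have high: "norm (?J j x) \<le> E" if "\<mu> j \<le> \<bar>x\<bar>" for x
  proof -
    have *: "\<mu> 0 / 2 \<le> \<bar>x\<bar> - (\<Sum>i<j. \<mu> i)"
      using that lac[of j] mono[of 0 j] mu[of 0] mu[of j] by linarith
    have "norm (?J j x) \<le> (1 + c) ^ j * (2 / (\<bar>x\<bar> - (\<Sum>i<j. \<mu> i)))"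
    proof (rule norm_riesz_transform_le[OF ab c(1) less_imp_le[OF mu]])
      show "(\<Sum>i<j. \<mu> i) < \<bar>x\<bar>" using * mu[of 0] by linarith
    qed
    also have "\<dots> \<le> (1 + c) ^ n * (2 / (\<mu> 0 / 2))"
    proof (intro mult_mono pow divide_left_mono mult_pos_pos *)
      show "0 < \<bar>x\<bar> - (\<Sum>i<j. \<mu> i)" "0 \<le> 2 / (\<bar>x\<bar> - (\<Sum>i<j. \<mu> i))"
        using * mu[of 0] by auto
    qed (use mu[of 0] c j in auto)
    finally show ?thesis by (simp add: E_def mult.commute)
  qed
  have 2: "norm (?J j 0 - of_real (b - a)) \<le> real n * E"
  proof -
    have "norm (?J j 0 - of_real (b - a)) \<le> real j * (4 * (1 + c) ^ j / \<mu> 0)"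
      using riesz_transform_low_frequency[OF ab c mu lac, of 0 j] ab mu[of 0]
      by (simp add: scaleR_conv_of_real)
    also have "\<dots> \<le> real n * E"
      unfolding E_def using j c mu[of 0]
      by (intro mult_mono divide_right_mono pow) auto
    finally show ?thesis .
  qed
  have "?J (Suc j) (- \<mu> j) - \<i> * of_real (c / 2 * (b - a)) =
      ?J j (- \<mu> j) + \<i> * of_real (c / 2) * ((?J j 0 - of_real (b - a)) + ?J j (- (2 * \<mu> j)))"
    by (simp add: riesz_transform_Suc field_simps)
  also have "norm \<dots> \<le> norm (?J j (- \<mu> j)) +
      norm (\<i> * of_real (c / 2) * ((?J j 0 - of_real (b - a)) + ?J j (- (2 * \<mu> j))))"
    by (rule norm_triangle_ineq)
  also have "\<dots> = norm (?J j (- \<mu> j)) +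
      c / 2 * norm ((?J j 0 - of_real (b - a)) + ?J j (- (2 * \<mu> j)))"
    using c by (simp add: norm_mult)
  also have "\<dots> \<le> E + 1 * (real n * E + E)"
    using c mu[of j] high[of "- \<mu> j"] high[of "- (2 * \<mu> j)"] 2 E0
    by (intro add_mono mult_mono order.trans[OF norm_triangle_ineq]) auto
  finally have 3: "norm (?J (Suc j) (- \<mu> j) - \<i> * of_real (c / 2 * (b - a))) \<le> (real n + 2) * E"
    by (simp add: algebra_simps)
  have "norm (?J n (- \<mu> j) - \<i> * of_real (c / 2 * (b - a))) \<le> real n * E + (real n + 2) * E"
    using norm_triangle_ineq[of "?J n (- \<mu> j) - ?J (Suc j) (- \<mu> j)"
      "?J (Suc j) (- \<mu> j) - \<i> * of_real (c / 2 * (b - a))"] 1 3 by simp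
  then show ?thesis by (simp add: E_def[symmetric] algebra_simps)
qed

text \<open>The bound involves a lower bound \<nu> of the frequency, so that all frequencies of one
  block can share it.\<close>

lemma riesz_transform_high_frequency:
  assumes ab: "a \<le> b" and c: "0 \<le> c" and mu: "\<And>i. 0 < \<mu> i"
    and nu: "0 < \<nu>" "4 * (\<Sum>i<n. \<mu> i) \<le> \<nu>" "\<nu> \<le> \<bar>x\<bar>"
  shows "norm (riesz_transform c \<mu> a b n x) \<le> 4 * (1 + c) ^ n / \<nu>"
proof -
  have *: "\<nu> / 2 \<le> \<bar>x\<bar> - (\<Sum>i<n. \<mu> i)" using nu by linarith
  have "norm (riesz_transform c \<mu> a b n x) \<le> (1 + c) ^ n * (2 / (\<bar>x\<bar> - (\<Sum>i<n. \<mu> i)))"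
    using * nu mu by (intro norm_riesz_transform_le ab c) (auto intro: less_imp_le)
  also have "\<dots> \<le> (1 + c) ^ n * (2 / (\<nu> / 2))"
    using * nu c by (intro mult_left_mono divide_left_mono mult_pos_pos) auto
  finally show ?thesis by (simp add: mult.commute)
qed

subsection \<open>The block series\<close>

text \<open>\<open>main_freq k\<close> and \<open>block_freq k l\<close> are the logarithms of
  3^(64^k) and of 2^l 3^(64^k), the integers whose powers make up block k.\<close>

definition main_freq :: "nat \<Rightarrow> real" where
  "main_freq k = 64 ^ k * ln 3"

definition block_freq :: "nat \<Rightarrow> nat \<Rightarrow> real" where
  "block_freq k l = main_freq k + real l * ln 2"

text \<open>Binomial probabilities: a block is a convex combination of exponentials, and any bound
  uniform in l passes to it without loss.\<close>

definition block_weight :: "nat \<Rightarrow> nat \<Rightarrow> real" where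
  "block_weight k l = real (2 ^ k choose l) / 2 ^ (2 ^ k)"

definition block :: "nat \<Rightarrow> complex \<Rightarrow> complex" where
  "block k s = exp (- of_real (main_freq k) * s) * ((1 + exp (- of_real (ln 2) * s)) / 2) ^ (2 ^ k)"

definition block_series :: "complex \<Rightarrow> complex" where
  "block_series s = suminf (\<lambda>k. block k s)"

lemma main_freq_pos: "0 < main_freq k"
  by (simp add: main_freq_def)

lemma main_freq_ge: "64 ^ k \<le> main_freq k"
proof -
  have "exp 1 \<le> (3 :: real)" by (rule exp_le)
  then have "1 \<le> ln (3 :: real)" by (subst ln_ge_iff) auto
  then show ?thesis by (simp add: main_freq_def)
qed

lemma main_freq_add: "main_freq (k + n) = 64 ^ n * main_freq k"
  by (simp add: main_freq_def power_add)

lemma main_freq_mono: "j \<le> k \<Longrightarrow> main_freq j \<le> main_freq k"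
  by (simp add: main_freq_def)

text \<open>The spread 2^k ln 2 is at most 64^k ln 3, so a block stays within one octave and can be
  estimated like a single lacunary term.\<close>

lemma block_freq_bounds:
  assumes "l \<le> 2 ^ k"
  shows "main_freq k \<le> block_freq k l" "block_freq k l \<le> 2 * main_freq k"
proof -
  show "main_freq k \<le> block_freq k l" by (simp add: block_freq_def)
  have "real l \<le> 2 ^ k" using assms by (metis of_nat_le_iff of_nat_numeral of_nat_power)
  also have "\<dots> \<le> (64 :: real) ^ k" by (intro power_mono) auto
  finally have "real l \<le> 64 ^ k" .
  moreover have "ln 2 \<le> ln (3 :: real)" by simp
  ultimately have "real l * ln 2 \<le> 64 ^ k * ln 3"
    by (intro mult_mono) auto
  then show "block_freq k l \<le> 2 * main_freq k"
    by (simp add: block_freq_def main_freq_def mult.commute)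
qed

lemma block_freq_pos: "0 < block_freq k l"
  using main_freq_pos[of k] by (simp add: block_freq_def add_pos_nonneg)

lemma block_weight_nonneg: "0 \<le> block_weight k l"
  by (simp add: block_weight_def)

lemma sum_block_weight: "(\<Sum>l\<le>2 ^ k. block_weight k l) = 1"
  using choose_row_sum[of "2 ^ k"]
  by (simp add: block_weight_def flip: sum_divide_distrib of_nat_sum)

lemma power_half_one_plus:
  fixes z :: "'a :: field_char_0"
  shows "((1 + z) / 2) ^ m = (\<Sum>l\<le>m. of_nat (m choose l) / 2 ^ m * z ^ l)"
  using binomial_ring[of z 1 m]
  by (simp add: power_divide add.commute sum_divide_distrib)

lemma block_expand:
  "block k s = (\<Sum>l\<le>2 ^ k. of_real (block_weight k l) * exp (- of_real (block_freq k l) * s))"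
proof -
  have "exp (- of_real (main_freq k) * s) * exp (- of_real (ln 2) * s) ^ l
      = exp (- of_real (block_freq k l) * s)" for l
    by (simp add: block_freq_def algebra_simps flip: exp_of_nat_mult exp_add)
  then show ?thesis
    unfolding block_def power_half_one_plus sum_distrib_left
    by (intro sum.cong refl) (simp add: block_weight_def algebra_simps)
qed

lemma norm_half_one_plus_exp_le:
  assumes "0 \<le> Re s"
  shows "norm ((1 + exp (- of_real (ln 2) * s)) / 2) \<le> 1"
proof -
  have "norm (1 + exp (- of_real (ln 2) * s)) \<le> 1 + exp (- (ln 2 * Re s))"
    by (rule order.trans[OF norm_triangle_ineq]) simp
  also have "\<dots> \<le> 1 + 1" using assms by (intro add_left_mono) simp
  finally show ?thesis by (simp add: norm_divide)
qed

lemma norm_block_le: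
  assumes "0 \<le> Re s"
  shows "norm (block k s) \<le> exp (- (main_freq k * Re s))"
proof -
  have "norm (block k s) \<le> exp (- (main_freq k * Re s)) * 1"
    unfolding block_def norm_mult norm_power
    by (intro mult_mono power_le_one norm_half_one_plus_exp_le assms) auto
  then show ?thesis by simp
qed

section \<open>Convergence in the half-plane and the Bloch norm\<close>

lemma summable_exp_main_freq:
  assumes "0 < \<sigma>"
  shows "summable (\<lambda>k. exp (- (main_freq k * \<sigma>)))"
proof (rule summable_comparison_test')
  show "summable (\<lambda>k. (1 / 64) ^ k * (1 / \<sigma>) :: real)"
    by (intro summable_mult2 summable_geometric) simp
  fix k :: nat assume "0 \<le> k"
  have "64 ^ k * \<sigma> \<le> main_freq k * \<sigma>"
    using main_freq_ge[of k] assms by simp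
  also have "\<dots> \<le> exp (main_freq k * \<sigma>)"
    using exp_ge_add_one_self[of "main_freq k * \<sigma>"] by linarith
  finally have "inverse (exp (main_freq k * \<sigma>)) \<le> inverse (64 ^ k * \<sigma>)"
    using assms by (intro le_imp_inverse_le) auto
  then show "norm (exp (- (main_freq k * \<sigma>))) \<le> (1 / 64) ^ k * (1 / \<sigma>)"
    by (simp add: exp_minus divide_simps)
qed

text \<open>Uniformity in \<sigma> comes from telescoping: since the frequencies have ratio 64, x
  exp (-x) with x = \<sigma> \<open>main_freq k\<close> is at most a constant times the increment
  exp (-x / 64) - exp (-x).\<close>

lemma sum_main_freq_exp_le:
  assumes "0 \<le> \<sigma>"
  shows "(\<Sum>k<n. \<sigma> * main_freq k * exp (- (main_freq k * \<sigma>))) \<le> 2"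
proof -
  \<comment> \<open>Dividing by 64 stands for the index k - 1 and also makes sense at k = 0.\<close>
  define g where "g k = exp (- (main_freq k / 64 * \<sigma>))" for k
  have gS: "g (Suc k) = exp (- (main_freq k * \<sigma>))" for k
    by (simp add: g_def main_freq_def)
  have step: "\<sigma> * main_freq k * exp (- (main_freq k * \<sigma>)) \<le> 64 / 63 * (g k - g (Suc k))" for k
  proof -
    let ?d = "63 / 64 * (main_freq k * \<sigma>)"
    have "g k = exp (- (main_freq k * \<sigma>)) * exp ?d"
      by (simp add: g_def flip: exp_add)
    moreover have "exp (- (main_freq k * \<sigma>)) * (1 + ?d) \<le> exp (- (main_freq k * \<sigma>)) * exp ?d"
      by (intro mult_left_mono exp_ge_add_one_self) auto
    ultimately show ?thesis unfolding gS by (simp add: algebra_simps)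
  qed
  have "(\<Sum>k<n. \<sigma> * main_freq k * exp (- (main_freq k * \<sigma>))) \<le> (\<Sum>k<n. 64 / 63 * (g k - g (Suc k)))"
    by (intro sum_mono step)
  also have "\<dots> = 64 / 63 * (g 0 - g n)"
    by (simp only: sum_lessThan_telescope' flip: sum_distrib_left)
  also have "\<dots> \<le> 64 / 63 * (1 - 0)"
  proof (intro mult_left_mono diff_mono)
    show "g 0 \<le> 1" using assms main_freq_pos[of 0] by (simp add: g_def)
  qed (auto simp: g_def)
  finally show ?thesis by simp
qed

definition block_deriv :: "nat \<Rightarrow> complex \<Rightarrow> complex" where
  "block_deriv k s =
     (\<Sum>l\<le>2 ^ k. of_real (block_weight k l) * (- of_real (block_freq k l) * exp (- of_real (block_freq k l) * s)))"

lemma has_field_derivative_block: "(block k has_field_derivative block_deriv k s) (at s)"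
proof -
  have "((\<lambda>s. \<Sum>l\<le>2 ^ k. of_real (block_weight k l) * exp (- of_real (block_freq k l) * s))
      has_field_derivative block_deriv k s) (at s)"
    unfolding block_deriv_def by (auto intro!: derivative_eq_intros sum.cong)
  then show ?thesis
    by (simp add: block_expand[abs_def])
qed

lemma norm_block_deriv_le:
  assumes "0 \<le> Re s"
  shows "norm (block_deriv k s) \<le> 2 * main_freq k * exp (- (main_freq k * Re s))"
proof -
  have "norm (block_deriv k s) \<le>
      (\<Sum>l\<le>2 ^ k. block_weight k l * (2 * main_freq k * exp (- (main_freq k * Re s))))"
    unfolding block_deriv_def
  proof (rule sum_norm_le)
    fix l :: nat assume "l \<in> {..2 ^ k}"
    then have b: "main_freq k \<le> block_freq k l" "block_freq k l \<le> 2 * main_freq k"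
      using block_freq_bounds by auto
    have "block_freq k l * exp (- (block_freq k l * Re s)) \<le>
        2 * main_freq k * exp (- (main_freq k * Re s))"
      using b assms main_freq_pos[of k] by (intro mult_mono) (auto intro: mult_right_mono)
    then show "norm (of_real (block_weight k l) *
        (- of_real (block_freq k l) * exp (- of_real (block_freq k l) * s))) \<le>
      block_weight k l * (2 * main_freq k * exp (- (main_freq k * Re s)))"
      using block_freq_pos[of k l] block_weight_nonneg[of k l]
      by (simp add: norm_mult mult_left_mono)
  qed
  also have "\<dots> = 2 * main_freq k * exp (- (main_freq k * Re s))"
    by (simp add: sum_block_weight flip: sum_distrib_right)
  finally show ?thesis .
qed

lemma block_series_sums:
  assumes "0 < Re s"
  shows "(\<lambda>k. block k s) sums block_series s"
    and "(block_series has_field_derivative (suminf (\<lambda>k. block_deriv k s))) (at s)"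
proof -
  have "\<exists>g g'. \<forall>x\<in>right_half_plane. ((\<lambda>n. block n x) sums g x) \<and>
      ((\<lambda>n. block_deriv n x) sums g' x) \<and> (g has_field_derivative g' x) (at x)"
  proof (rule series_and_derivative_comparison_complex)
    show "open right_half_plane"
      unfolding right_half_plane_def by (rule open_halfspace_Re_gt)
    show "(block n has_field_derivative block_deriv n x) (at x)" for n x
      by (rule has_field_derivative_block)
    fix x assume x: "x \<in> right_half_plane"
    \<comment> \<open>On the ball of radius \<open>Re x / 2\<close> the real part stays above
      \<open>Re x / 2\<close>, so one majorant serves all its points.\<close>
    define h where "h n = complex_of_real (exp (- (main_freq n * (Re x / 2))))" for n
    have "norm (block n y) \<le> norm (h n)" if "y \<in> ball x (Re x / 2)" for n y
    proof -
      have "\<bar>Re (x - y)\<bar> < Re x / 2"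
        using that abs_Re_le_cmod[of "x - y"] by (simp add: dist_norm)
      then have y: "Re x / 2 \<le> Re y" by (simp add: abs_if split: if_splits)
      have "norm (block n y) \<le> exp (- (main_freq n * Re y))"
        using x y by (intro norm_block_le) (simp add: right_half_plane_def)
      also have "\<dots> \<le> norm (h n)"
        using y main_freq_pos[of n] by (simp add: h_def)
      finally show ?thesis .
    qed
    moreover have "summable h"
      unfolding h_def using x summable_exp_main_freq[of "Re x / 2"]
      by (intro summable_of_real) (simp add: right_half_plane_def)
    moreover have "range h \<subseteq> \<real>\<^sub>\<ge>\<^sub>0" by (auto simp: h_def)
    ultimately show "\<exists>d h. 0 < d \<and> summable h \<and> range h \<subseteq> \<real>\<^sub>\<ge>\<^sub>0 \<and>
        (\<forall>\<^sub>F n in sequentially. \<forall>y\<in>ball x d \<inter> right_half_plane. cmod (block n y) \<le> cmod (h n))"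
      using x by (intro exI[of _ "Re x / 2"] exI[of _ h]) (auto simp: right_half_plane_def)
  qed
  then obtain g g' where g: "\<And>x. x \<in> right_half_plane \<Longrightarrow> (\<lambda>n. block n x) sums g x"
    "\<And>x. x \<in> right_half_plane \<Longrightarrow> (\<lambda>n. block_deriv n x) sums g' x"
    "\<And>x. x \<in> right_half_plane \<Longrightarrow> (g has_field_derivative g' x) (at x)" by blast
  have s: "s \<in> right_half_plane" using assms by (simp add: right_half_plane_def)
  have eq: "block_series x = g x" if "x \<in> right_half_plane" for x
    using g(1)[OF that] by (simp add: block_series_def sums_iff)
  show "(\<lambda>k. block k s) sums block_series s"
    using g(1)[OF s] eq[OF s] by simp
  have "(block_series has_field_derivative g' s) (at s)"
  proof (rule has_field_derivative_transform_within_open[OF g(3)[OF s] _ s])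
    show "open right_half_plane"
      unfolding right_half_plane_def by (rule open_halfspace_Re_gt)
  qed (simp add: eq)
  then show "(block_series has_field_derivative (suminf (\<lambda>k. block_deriv k s))) (at s)"
    using g(2)[OF s] by (simp add: sums_iff)
qed

lemma block_series_Bloch: "block_series \<in> Bloch"
proof -
  \<comment> \<open>4 = 2 * 2: one factor from the octave width in
    \<open>norm_block_deriv_le\<close>, one from \<open>sum_main_freq_exp_le\<close>.\<close>
  have "Re s * norm (deriv block_series s) \<le> 4" if "s \<in> right_half_plane" for s
  proof -
    have s: "0 < Re s" using that by (simp add: right_half_plane_def)
    let ?h = "\<lambda>k. 2 / Re s * (Re s * main_freq k * exp (- (main_freq k * Re s)))"
    have bd: "norm (block_deriv k s) \<le> ?h k" for k
      using norm_block_deriv_le[of s k] s by simp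
    have nonneg: "0 \<le> Re s * main_freq k * exp (- (main_freq k * Re s))" for k
      using s main_freq_pos[of k] by simp
    have sums: "summable (\<lambda>k. Re s * main_freq k * exp (- (main_freq k * Re s)))"
      using sum_main_freq_exp_le[of "Re s"] s nonneg
      by (intro bounded_imp_summable[of _ 2]) (auto simp del: sum.lessThan_Suc simp flip: lessThan_Suc_atMost)
    have "deriv block_series s = suminf (\<lambda>k. block_deriv k s)"
      using block_series_sums(2)[OF s] by (rule DERIV_imp_deriv)
    also have "norm \<dots> \<le> suminf ?h"
      by (intro norm_suminf_le bd summable_mult sums)
    also have "\<dots> = 2 / Re s * suminf (\<lambda>k. Re s * main_freq k * exp (- (main_freq k * Re s)))"
      by (rule suminf_mult[OF sums])
    also have "\<dots> \<le> 2 / Re s * 2"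
      using s sum_main_freq_exp_le[of "Re s"] by (intro mult_left_mono suminf_le_const sums) auto
    finally show ?thesis using s by (simp add: field_simps)
  qed
  moreover have "block_series holomorphic_on right_half_plane"
    unfolding holomorphic_on_def
    by (auto simp: right_half_plane_def field_differentiable_def intro!: has_field_derivative_at_within block_series_sums(2))
  ultimately show ?thesis
    unfolding Bloch_def by (auto intro!: bdd_aboveI2)
qed

section \<open>Coefficients, and the Dirichlet series in the order of the integers\<close>

definition block_index :: "(nat \<times> nat) set" where
  "block_index = (SIGMA k:UNIV. {..2 ^ k})"

definition block_number :: "nat \<times> nat \<Rightarrow> nat" where
  "block_number = (\<lambda>(k, l). 2 ^ l * 3 ^ (64 ^ k))"

text \<open>The inverse is meaningful because \<open>block_number\<close> is injective on all pairs,
  by unique factorization; hence no two terms of the blocks merge into one coefficient.\<close>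

definition block_coeff :: "nat \<Rightarrow> complex" where
  "block_coeff n =
     (if n \<in> block_number ` block_index
      then of_real (case_prod block_weight (inv block_number n)) else 0)"

lemma block_number_pos: "0 < block_number j"
  by (simp add: block_number_def split: prod.split)

text \<open>Used twice: for the injectivity of \<open>block_number\<close> and for the exponents in
  the Bohr lift.\<close>

lemma multiplicity_2_power_3_power:
  assumes "prime p"
  shows "multiplicity p (2 ^ l * 3 ^ m :: nat) = (if p = 2 then l else if p = 3 then m else 0)"
proof -
  have p3: "prime (3 :: nat)" by simp
  have "multiplicity p (2 ^ l * 3 ^ m :: nat) = multiplicity p (2 ^ l :: nat) + multiplicity p (3 ^ m :: nat)"
    using assms by (intro prime_elem_multiplicity_mult_distrib) auto
  also have "\<dots> = l * multiplicity p (2 :: nat) + m * multiplicity p (3 :: nat)"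
    using assms by (simp add: prime_elem_multiplicity_power_distrib)
  also have "\<dots> = (if p = 2 then l else if p = 3 then m else 0)"
    using assms p3 by (simp add: prime_multiplicity_other)
  finally show ?thesis .
qed

lemma inj_block_number: "inj block_number"
proof (rule injI, clarify)
  fix k l k' l' assume eq: "block_number (k, l) = block_number (k', l')"
  have p3: "prime (3 :: nat)" by simp
  from eq have "multiplicity p (2 ^ l * 3 ^ (64 ^ k) :: nat) = multiplicity p (2 ^ l' * 3 ^ (64 ^ k'))" for p
    by (simp add: block_number_def)
  from this[of 2] this[of 3] show "k = k' \<and> l = l'"
    using p3 by (simp add: multiplicity_2_power_3_power del: prime_nat_numeral_eq)
qed

lemma block_coeff_number: "l \<le> 2 ^ k \<Longrightarrow> block_coeff (block_number (k, l)) = of_real (block_weight k l)"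
  using inj_block_number by (auto simp: block_coeff_def block_index_def)

lemma block_number_powr:
  fixes s :: complex
  shows "of_nat (block_number (k, l)) powr - s = exp (- of_real (block_freq k l) * s)"
proof -
  have "ln (real (block_number (k, l))) = block_freq k l"
    by (simp add: block_number_def block_freq_def main_freq_def ln_mult ln_realpow)
  then have "Ln (of_nat (block_number (k, l)) :: complex) = of_real (block_freq k l)"
    using block_number_pos[of "(k, l)"] Ln_of_real[of "real (block_number (k, l))"] by simp
  then show ?thesis
    using block_number_pos[of "(k, l)"] by (simp add: powr_def mult.commute)
qed

text \<open>The definition of the function sums by blocks, a Dirichlet series by increasing n. The
  double series over pairs (k, l) converges absolutely for Re s > 0, so both orders give the same
  sum.\<close>

lemma block_series_has_dirichlet_series: "has_dirichlet_series block_series block_coeff"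
  unfolding has_dirichlet_series_def
proof (intro exI[of _ 0] conjI allI impI order_refl)
  fix s :: complex assume s: "0 < Re s"
  define t where "t = (\<lambda>(k, l). of_real (block_weight k l) * exp (- of_real (block_freq k l) * s))"
  have block: "((\<lambda>l. t (k, l)) has_sum block k s) {..2 ^ k}" for k
    unfolding block_expand t_def by simp
  have "(\<lambda>j. norm (t j)) summable_on block_index"
    unfolding block_index_def
  proof (rule summable_on_SigmaI)
    show "((\<lambda>l. norm (t (k, l))) has_sum (\<Sum>l\<le>2 ^ k. norm (t (k, l)))) {..2 ^ k}" for k
      by (rule has_sum_finite) simp
    have le: "(\<Sum>l\<le>2 ^ k. norm (t (k, l))) \<le> exp (- (main_freq k * Re s))" for k
    proof -
      have "(\<Sum>l\<le>2 ^ k. norm (t (k, l))) \<le> (\<Sum>l\<le>2 ^ k. block_weight k l * exp (- (main_freq k * Re s)))"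
        using s by (intro sum_mono)
          (auto simp: t_def norm_mult block_weight_nonneg
            intro!: mult_left_mono mult_right_mono block_freq_bounds)
      also have "\<dots> = exp (- (main_freq k * Re s))"
        by (simp add: sum_block_weight flip: sum_distrib_right)
      finally show ?thesis .
    qed
    have "summable (\<lambda>k. \<Sum>l\<le>2 ^ k. norm (t (k, l)))"
      by (rule summable_comparison_test'[OF summable_exp_main_freq[OF s], of 0])
        (use le in \<open>auto simp: sum_nonneg\<close>)
    then show "(\<lambda>k. \<Sum>l\<le>2 ^ k. norm (t (k, l))) summable_on UNIV"
      by (subst summable_on_UNIV_nonneg_real_iff) (auto simp: sum_nonneg)
  qed auto
  then have "t summable_on block_index"
    by (rule abs_summable_summable)
  moreover have "((\<lambda>k. block k s) has_sum block_series s) UNIV"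
  proof (rule norm_summable_imp_has_sum[OF _ block_series_sums(1)[OF s]])
    show "summable (\<lambda>k. norm (block k s))"
      by (rule summable_comparison_test'[OF summable_exp_main_freq[OF s], of 0])
        (use s norm_block_le[of s] in auto)
  qed
  ultimately have "(t has_sum block_series s) block_index"
    unfolding block_index_def by (intro has_sum_SigmaI[OF block])
  also have "?this \<longleftrightarrow> (((\<lambda>n. block_coeff n * of_nat n powr - s) \<circ> block_number) has_sum block_series s) block_index"
    by (intro has_sum_cong)
      (auto simp: t_def block_index_def block_coeff_number block_number_powr)
  also have "\<dots> \<longleftrightarrow> ((\<lambda>n. block_coeff n * of_nat n powr - s) has_sum block_series s) (block_number ` block_index)"
    by (rule has_sum_reindex[symmetric]) (rule inj_on_subset[OF inj_block_number subset_UNIV])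
  \<comment> \<open>All other positive integers have coefficient 0; the next step shifts the index
    so that the sum starts at 1.\<close>
  also have "\<dots> \<longleftrightarrow> ((\<lambda>n. block_coeff n * of_nat n powr - s) has_sum block_series s) {0<..}"
    by (rule has_sum_cong_neutral) (auto simp: block_number_pos block_coeff_def)
  also have "\<dots> \<longleftrightarrow> ((\<lambda>n. block_coeff (Suc n) * of_nat (Suc n) powr - s) has_sum block_series s) UNIV"
    by (rule has_sum_reindex_bij_witness[of _ Suc "\<lambda>n. n - 1"]) auto
  finally show "(\<lambda>n. block_coeff (Suc n) * of_nat (Suc n) powr - s) sums block_series s"
    by (rule has_sum_imp_sums)
qed

subsection \<open>Boundary values and mean oscillation\<close>

lemma block_imaginary_axis:
  "block k (Complex 0 t) = (\<Sum>l\<le>2 ^ k. of_real (block_weight k l) * cis (- block_freq k l * t))"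
  unfolding block_expand by (intro sum.cong refl) (simp add: cis_conv_exp Complex_eq algebra_simps)

lemma norm_block_imaginary_axis_le: "norm (block k (Complex 0 t)) \<le> 1"
  using norm_block_le[of "Complex 0 t" k] by simp

lemma continuous_on_block [continuous_intros]:
  "continuous_on A f \<Longrightarrow> continuous_on A (\<lambda>x. block k (f x))"
  unfolding block_def by (intro continuous_intros) auto

text \<open>The modulus of (1 + 2^(-i d)) / 2.\<close>

definition decay_rate :: "real \<Rightarrow> real" where
  "decay_rate d = sqrt ((1 + cos (d * ln 2)) / 2)"

lemma decay_rate_nonneg: "0 \<le> decay_rate d"
  using add_left_mono[OF cos_ge_minus_one[of "d * ln 2"], of 1] by (simp add: decay_rate_def)

lemma ln_2_bounds: "0 < ln (2 :: real)" "ln (2 :: real) \<le> 1"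
  using ln_2_less_1 by auto

lemma decay_rate_less_1:
  assumes "0 < d" "d \<le> 1"
  shows "decay_rate d < 1"
proof -
  have "d * ln 2 \<le> 1 * 1" using assms ln_2_bounds by (intro mult_mono) auto
  then have "cos (d * ln 2) < cos 0"
    using assms pi_gt3 by (intro cos_monotone_0_pi) auto
  then show ?thesis by (simp add: decay_rate_def)
qed

text \<open>Away from t = 0 the base of the power is bounded away from 1 in modulus, uniformly in
  \<sigma> down to the imaginary axis, where the exponential factor gives no decay.\<close>

lemma norm_block_decay:
  assumes "0 < d" "d \<le> t" "t \<le> 1" "0 \<le> \<sigma>"
  shows "norm (block k (Complex \<sigma> t)) \<le> decay_rate d ^ k"
proof -
  let ?w = "(1 + exp (- of_real (ln 2) * Complex \<sigma> t)) / 2"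
  define x where "x = exp (- (\<sigma> * ln 2))"
  have x: "0 \<le> x" "x \<le> 1" using assms by (auto simp: x_def)
  have t: "t * ln 2 \<le> 1" using mult_mono[of t 1 "ln 2" 1] assms ln_2_bounds by auto
  have c: "cos (t * ln 2) \<le> cos (d * ln 2)"
    using assms t pi_gt3 by (intro cos_monotone_0_pi_le mult_right_mono) auto
  \<comment> \<open>With a nonnegative cosine the modulus grows with x, so x = 1, that is \<sigma> =
    0, is the worst case.\<close>
  have "0 \<le> cos (t * ln 2)"
    using assms t pi_gt3 ln_2_bounds
    by (intro cos_ge_zero) (auto intro: order.trans[of _ 0])
  have e: "exp (- of_real (ln 2) * Complex \<sigma> t) = x * cis (- (t * ln 2))"
    by (simp add: x_def complex_eq_iff Re_exp Im_exp algebra_simps)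
  have "(norm (1 + of_real x * cis (- (t * ln 2))))\<^sup>2 = 1 + 2 * (x * cos (t * ln 2)) + x\<^sup>2"
  proof -
    have "(norm (1 + of_real x * cis (- (t * ln 2))))\<^sup>2 = (1 + x * cos (t * ln 2))\<^sup>2 + (x * sin (t * ln 2))\<^sup>2"
      by (simp add: cmod_power2)
    also have "\<dots> = 1 + 2 * (x * cos (t * ln 2)) + x\<^sup>2 * ((sin (t * ln 2))\<^sup>2 + (cos (t * ln 2))\<^sup>2)"
      by algebra
    also have "\<dots> = 1 + 2 * (x * cos (t * ln 2)) + x\<^sup>2"
      unfolding sin_cos_squared_add by simp
    finally show ?thesis .
  qed
  also have "\<dots> \<le> 1 + 2 * (1 * cos (t * ln 2)) + 1\<^sup>2"
    using x \<open>0 \<le> cos (t * ln 2)\<close>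
    by (intro add_mono mult_left_mono mult_right_mono power_mono) auto
  also have "\<dots> \<le> 2 * (1 + cos (d * ln 2))" using c by simp
  finally have "(norm ?w)\<^sup>2 \<le> (1 + cos (d * ln 2)) / 2"
    unfolding e by (simp add: norm_divide power_divide)
  then have w: "norm ?w \<le> decay_rate d"
    unfolding decay_rate_def by (rule real_le_rsqrt)
  have "norm (block k (Complex \<sigma> t)) = exp (- (main_freq k * \<sigma>)) * norm ?w ^ (2 ^ k)"
    by (simp add: block_def norm_mult norm_power)
  also have "\<dots> \<le> 1 * decay_rate d ^ (2 ^ k)"
    using assms main_freq_pos[of k] w by (intro mult_mono power_mono) auto
  \<comment> \<open>Lowering the exponent from 2^k to k still leaves a convergent geometric
    series.\<close>
  also have "\<dots> \<le> decay_rate d ^ k"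
    using decay_rate_less_1[of d] assms decay_rate_nonneg[of d] less_exp[of k]
    by (auto intro!: power_decreasing)
  finally show ?thesis .
qed

text \<open>The region contains a piece of the imaginary axis. The resulting continuity up to the
  boundary makes \<open>boundary_value\<close> the sum of the series there, for every t in (0,
  1].\<close>

lemma block_series_uniform_limit:
  assumes "0 < d"
  shows "uniform_limit {s. 0 \<le> Re s \<and> d \<le> Im s \<and> Im s \<le> 1}
    (\<lambda>n s. \<Sum>k<n. block k s) block_series sequentially"
proof (cases "d \<le> 1")
  case True
  show ?thesis
    unfolding block_series_def[abs_def]
  proof (rule Weierstrass_m_test)
    show "summable (\<lambda>k. decay_rate d ^ k)"
      using assms True decay_rate_less_1[of d] decay_rate_nonneg[of d]
      by (intro summable_geometric) simp
    show "norm (block k s) \<le> decay_rate d ^ k" if "s \<in> {s. 0 \<le> Re s \<and> d \<le> Im s \<and> Im s \<le> 1}" for k s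
      using norm_block_decay[OF assms, of "Im s" "Re s" k] that by simp
  qed
next
  case False
  then have empty: "{s. 0 \<le> Re s \<and> d \<le> Im s \<and> Im s \<le> 1} = {}" by auto
  show ?thesis unfolding empty by simp
qed

lemma continuous_on_block_series:
  assumes "0 < d"
  shows "continuous_on {s. 0 \<le> Re s \<and> d \<le> Im s \<and> Im s \<le> 1} block_series"
  by (rule uniform_limit_theorem[OF _ block_series_uniform_limit[OF assms]])
    (auto intro!: always_eventually continuous_intros)

lemma boundary_value_block_series:
  assumes "0 < t" "t \<le> 1"
  shows "boundary_value block_series t = block_series (Complex 0 t)"
proof -
  have "continuous_on {0..} (\<lambda>\<sigma>. block_series (Complex \<sigma> t))"
    using assms
    by (intro continuous_on_compose2[OF continuous_on_block_series[of t]])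
      (auto simp: Complex_eq intro!: continuous_intros)
  then have "((\<lambda>\<sigma>. block_series (Complex \<sigma> t)) \<longlongrightarrow> block_series (Complex 0 t)) (at 0 within {0..})"
    by (simp add: continuous_on_def)
  then have "((\<lambda>\<sigma>. block_series (Complex \<sigma> t)) \<longlongrightarrow> block_series (Complex 0 t)) (at_right 0)"
    by (rule tendsto_mono[rotated]) (auto intro: at_le)
  then show ?thesis
    unfolding boundary_value_def by (intro tendsto_Lim) auto
qed

section \<open>Pairing the boundary function with test functions\<close>

lemma continuous_on_block_series_imaginary:
  assumes "0 < a" "b \<le> 1"
  shows "continuous_on {a..b} (\<lambda>t. block_series (Complex 0 t))"
  by (rule continuous_on_compose2[OF continuous_on_block_series[OF assms(1)]])
    (use assms in \<open>auto simp: Complex_eq intro!: continuous_intros\<close>)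

lemma block_series_integral_sums:
  fixes \<psi> :: "real \<Rightarrow> complex"
  assumes "0 < a" "b \<le> 1" and cont: "continuous_on {a..b} \<psi>"
  shows "(\<lambda>k. integral {a..b} (\<lambda>t. block k (Complex 0 t) * \<psi> t)) sums
    integral {a..b} (\<lambda>t. block_series (Complex 0 t) * \<psi> t)"
proof -
  have "uniform_limit {a..b} (\<lambda>n t. \<Sum>k<n. block k (Complex 0 t)) (\<lambda>t. block_series (Complex 0 t)) sequentially"
    by (rule uniform_limit_compose'[OF block_series_uniform_limit[OF assms(1)]])
      (use assms in auto)
  then have "uniform_limit {a..b} (\<lambda>n t. (\<Sum>k<n. block k (Complex 0 t)) * \<psi> t)
      (\<lambda>t. block_series (Complex 0 t) * \<psi> t) sequentially"
    by (intro uniform_lim_mult uniform_limit_const compact_imp_bounded compact_continuous_image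
        cont continuous_on_block_series_imaginary assms) auto
  then obtain I J where IJ: "\<And>n. ((\<lambda>t. (\<Sum>k<n. block k (Complex 0 t)) * \<psi> t) has_integral I n) {a..b}"
    "((\<lambda>t. block_series (Complex 0 t) * \<psi> t) has_integral J) {a..b}" "I \<longlonglongrightarrow> J"
    by (rule uniform_limit_integral)
      (auto intro!: continuous_intros cont simp: Complex_eq)
  have "I n = (\<Sum>k<n. integral {a..b} (\<lambda>t. block k (Complex 0 t) * \<psi> t))" for n
  proof -
    have "((\<lambda>t. \<Sum>k<n. block k (Complex 0 t) * \<psi> t) has_integral
        (\<Sum>k<n. integral {a..b} (\<lambda>t. block k (Complex 0 t) * \<psi> t))) {a..b}"
      by (intro has_integral_sum integrable_integral integrable_continuous_real continuous_intros cont)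
        (auto simp: Complex_eq intro!: continuous_intros)
    then show ?thesis
      using IJ(1)[of n] by (simp add: sum_distrib_right has_integral_unique)
  qed
  then have "I = (\<lambda>n. \<Sum>k<n. integral {a..b} (\<lambda>t. block k (Complex 0 t) * \<psi> t))" by blast
  then show ?thesis
    using IJ(2,3) by (simp add: sums_def integral_unique)
qed

text \<open>The block is a convex combination of pure waves, so a bound for each of its frequencies
  suffices.\<close>

lemma norm_block_integral_le:
  fixes \<psi> :: "real \<Rightarrow> complex"
  assumes cont: "continuous_on {a..b} \<psi>"
    and bd: "\<And>l. l \<le> 2 ^ k \<Longrightarrow> norm (integral {a..b} (\<lambda>t. cis (- block_freq k l * t) * \<psi> t)) \<le> B"
  shows "norm (integral {a..b} (\<lambda>t. block k (Complex 0 t) * \<psi> t)) \<le> B"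
proof -
  have "integral {a..b} (\<lambda>t. block k (Complex 0 t) * \<psi> t) =
      integral {a..b} (\<lambda>t. \<Sum>l\<le>2 ^ k. of_real (block_weight k l) * (cis (- block_freq k l * t) * \<psi> t))"
    by (simp add: block_imaginary_axis sum_distrib_right mult.assoc)
  also have "\<dots> = (\<Sum>l\<le>2 ^ k. of_real (block_weight k l) *
      integral {a..b} (\<lambda>t. cis (- block_freq k l * t) * \<psi> t))"
    by (subst Henstock_Kurzweil_Integration.integral_sum)
      (auto intro!: integrable_continuous_real continuous_intros cont)
  also have "norm \<dots> \<le> (\<Sum>l\<le>2 ^ k. block_weight k l * B)"
    using bd block_weight_nonneg by (intro sum_norm_le) (auto simp: norm_mult intro!: mult_left_mono)
  also have "\<dots> = B" by (simp add: sum_block_weight flip: sum_distrib_right)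
  finally show ?thesis .
qed

text \<open>For w in the closed unit disc, w^(2^k) - 1 has modulus at most 2^k |w - 1|, and here |w
  - 1| is at most t / 2.\<close>

lemma norm_block_minus_cis_le:
  assumes "0 \<le> t"
  shows "norm (block k (Complex 0 t) - cis (- main_freq k * t)) \<le> 2 ^ k * t / 2"
proof -
  let ?z = "cis (- (t * ln 2))"
  let ?w = "(1 + ?z) / 2"
  have w: "norm ?w \<le> 1"
    using norm_triangle_ineq[of 1 ?z] by (simp add: norm_divide)
  have "norm (?z - 1) \<le> t * 1"
  proof -
    have "norm (?z - 1) \<le> t * ln 2"
      using dist_exp_i_1[of "- (t * ln 2)"] abs_sin_x_le_abs_x[of "t * ln 2 / 2"] assms ln_2_bounds
      by (simp add: cis_conv_exp)
    also have "\<dots> \<le> t * 1" using assms ln_2_bounds by (intro mult_left_mono) auto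
    finally show ?thesis .
  qed
  moreover have "?w - 1 = (?z - 1) / 2" by (simp add: field_simps)
  ultimately have w1: "norm (?w - 1) \<le> t / 2" by (simp only: norm_divide) simp
  have "norm (?w ^ (2 ^ k) - 1 ^ (2 ^ k)) \<le> 2 ^ k * norm (?w - 1)"
    using norm_power_diff[of ?w 1 "2 ^ k"] w by simp
  also have "\<dots> \<le> 2 ^ k * (t / 2)" using w1 by (intro mult_left_mono) auto
  finally have "norm (?w ^ (2 ^ k) - 1) \<le> 2 ^ k * t / 2" by simp
  moreover have "block k (Complex 0 t) - cis (- main_freq k * t) = cis (- main_freq k * t) * (?w ^ (2 ^ k) - 1)"
    by (simp add: block_def cis_conv_exp Complex_eq algebra_simps)
  ultimately show ?thesis by (simp add: norm_mult)
qed

lemma main_freq_lacunary: "4 * (\<Sum>i<k. main_freq (n + i)) \<le> main_freq (n + k)"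
proof (induction k)
  case 0
  then show ?case using main_freq_pos[of n] by simp
next
  case (Suc k)
  have "main_freq (n + Suc k) = 64 * main_freq (n + k)" by (simp add: main_freq_def)
  then show ?case using Suc main_freq_pos[of "n + k"] by simp
qed

text \<open>F - m is paired with \<psi>, a Riesz product minus 1 with modulus at most 3, which is
  the factor in front of the oscillation. Blocks below N are too slow and blocks from 2N on too fast
  to interact with \<psi>; each of the N blocks between contributes about i c d / 2.\<close>

lemma block_series_oscillation:
  fixes N :: nat and d :: real and m :: complex
  assumes N: "1 \<le> N"
  defines "d \<equiv> 1 / 8 ^ N"
  defines "m \<equiv> integral {d..2 * d} (\<lambda>t. block_series (Complex 0 t)) / of_real d"
  shows "sqrt N / 2 * d \<le> 67 * d + 3 * integral {d..2 * d} (\<lambda>t. norm (block_series (Complex 0 t) - m))"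
proof -
  define F where "F t = block_series (Complex 0 t)" for t
  define c where "c = 1 / sqrt N"
  define \<mu> where "\<mu> i = main_freq (N + i)" for i
  \<comment> \<open>Without its constant term the test function almost annihilates m and the slow
    blocks.\<close>
  define \<psi> where "\<psi> t = riesz_product c \<mu> N t - 1" for t
  define E where "E = 4 * (1 + c) ^ N / \<mu> 0"
  define X where "X = integral {d..2 * d} (\<lambda>t. norm (F t - m))"
  have c: "0 \<le> c" "c \<le> 1" "real N * c\<^sup>2 \<le> 1" "N * c = sqrt N"
    using N by (auto simp: c_def power_divide real_div_sqrt)
  have d: "0 < d" by (simp add: d_def)
  have "(8 :: real) ^ 1 \<le> 8 ^ N" using N by (intro power_increasing) auto
  then have d1: "2 * d \<le> 1" by (simp add: d_def field_simps)
  have ab: "d \<le> 2 * d" using d by simp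
  have mu: "0 < \<mu> i" for i by (simp add: \<mu>_def main_freq_pos)
  have lac: "4 * (\<Sum>i<k. \<mu> i) \<le> \<mu> k" for k
    unfolding \<mu>_def by (rule main_freq_lacunary)
  have E0: "0 \<le> E" using c mu[of 0] by (simp add: E_def)
  have muE: "2 / \<mu> 0 \<le> E / 2"
  proof -
    have "1 \<le> (1 + c) ^ N" using c by simp
    then show ?thesis using mu[of 0] by (simp add: E_def divide_right_mono)
  qed
  have NN: "real N \<le> real N * real N" "1 \<le> real N * real N"
    using N mult_mono[of 1 "real N" 1 "real N"] by (auto simp: mult_le_cancel_left1)
  have N2: "real N \<le> 2 ^ N" by (simp add: of_nat_less_two_power less_imp_le)
  \<comment> \<open>The error budget: E is at most 4 * 2^N / 64^N and N^2 at most 4^N, and 8^N /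
    64^N = d.\<close>
  have NNE: "real N * real N * E \<le> 4 * d"
  proof -
    have "(1 + c) ^ N \<le> 2 ^ N" using c by (intro power_mono) auto
    moreover have "64 ^ N \<le> \<mu> 0" unfolding \<mu>_def using main_freq_ge[of N] by simp
    ultimately have "E \<le> 4 * 2 ^ N / 64 ^ N"
      unfolding E_def using c by (intro frac_le mult_left_mono) auto
    then have "real N * real N * E \<le> (2 ^ N * 2 ^ N) * (4 * 2 ^ N / 64 ^ N)"
      using E0 N2 by (intro mult_mono) auto
    also have "\<dots> = 4 * ((2 * 2 * 2) ^ N / (8 * 8) ^ N)"
      by (simp add: power_mult_distrib[symmetric])
    also have "\<dots> = 4 * d"
      unfolding d_def power_mult_distrib[of 8 8] by simp
    finally show ?thesis .
  qed
  have cont_\<psi>: "continuous_on {d..2 * d} \<psi>"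
    unfolding \<psi>_def by (intro continuous_intros)
  have cont_F: "continuous_on {d..2 * d} F"
    unfolding F_def by (rule continuous_on_block_series_imaginary[OF d d1])
  have norm_\<psi>: "norm (\<psi> t) \<le> 3" for t
    using norm_triangle_ineq4[of "riesz_product c \<mu> N t" 1] norm_riesz_product_le[OF c(3), of \<mu> t]
    by (simp add: \<psi>_def)
  have T: "integral {d..2 * d} (\<lambda>t. cis (\<nu> * t) * \<psi> t) =
      riesz_transform c \<mu> d (2 * d) N \<nu> - integral {d..2 * d} (\<lambda>t. cis (\<nu> * t))" for \<nu>
    unfolding riesz_transform_def \<psi>_def right_diff_distrib mult_1_right
    by (intro Henstock_Kurzweil_Integration.integral_diff integrable_continuous_real continuous_intros)
  have low: "norm (integral {d..2 * d} (\<lambda>t. cis (\<nu> * t) * \<psi> t)) \<le> N * E" if "4 * \<bar>\<nu>\<bar> \<le> \<mu> 0" for \<nu>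
    unfolding T E_def by (rule riesz_transform_low_frequency[OF ab c(1,2) mu lac that])

  define J where "J k = integral {d..2 * d} (\<lambda>t. block k (Complex 0 t) * \<psi> t)" for k
  have early: "norm (J k) \<le> N * E" if "k < N" for k
    unfolding J_def
  proof (intro norm_block_integral_le cont_\<psi> low)
    fix l :: nat assume "l \<le> 2 ^ k"
    then have "block_freq k l \<le> 2 * main_freq k" by (rule block_freq_bounds)
    moreover have "64 * main_freq k \<le> \<mu> 0"
      using main_freq_mono[of "Suc k" N] that by (simp add: \<mu>_def main_freq_def)
    ultimately show "4 * \<bar>- block_freq k l\<bar> \<le> \<mu> 0"
      using block_freq_pos[of k l] main_freq_pos[of k] by simp
  qed
  \<comment> \<open>(2N + 2) E is the resonance error, one more E comes from the -1 in \<psi>, and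
    the last term from replacing the block by a pure wave: for i < N and t at most 2d this costs 4^N
    d = 2^(-N), times the bound 3 for \<psi> and the length d.\<close>
  have middle: "norm (J (N + i) - \<i> * of_real (c / 2 * d)) \<le> (2 * N + 3) * E + 3 * d / 2 ^ N"
    if i: "i < N" for i
  proof -
    let ?e = "\<lambda>t. block (N + i) (Complex 0 t) - cis (- \<mu> i * t)"
    have cont_e: "continuous_on {d..2 * d} ?e"
      unfolding Complex_eq by (intro continuous_intros)
    have "J (N + i) = integral {d..2 * d} (\<lambda>t. cis (- \<mu> i * t) * \<psi> t + ?e t * \<psi> t)"
      unfolding J_def by (simp add: algebra_simps)
    also have "\<dots> = integral {d..2 * d} (\<lambda>t. cis (- \<mu> i * t) * \<psi> t) + integral {d..2 * d} (\<lambda>t. ?e t * \<psi> t)"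
      by (intro Henstock_Kurzweil_Integration.integral_add integrable_continuous_real
          continuous_on_mult cont_e cont_\<psi> continuous_intros)
    finally have "J (N + i) - \<i> * of_real (c / 2 * d) =
        (riesz_transform c \<mu> d (2 * d) N (- \<mu> i) - \<i> * of_real (c / 2 * (2 * d - d)))
        - integral {d..2 * d} (\<lambda>t. cis (- \<mu> i * t)) + integral {d..2 * d} (\<lambda>t. ?e t * \<psi> t)"
      unfolding T by simp
    also have "norm \<dots> \<le> real (2 * N + 2) * E + E + 3 * d / 2 ^ N"
    proof (intro norm_triangle_le[OF add_mono] norm_triangle_le_diff[OF add_mono])
      show "norm (riesz_transform c \<mu> d (2 * d) N (- \<mu> i) - \<i> * of_real (c / 2 * (2 * d - d)))
          \<le> real (2 * N + 2) * E"
        unfolding E_def by (rule riesz_transform_resonant[OF ab c(1,2) mu lac i])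
      have "norm (integral {d..2 * d} (\<lambda>t. cis (- \<mu> i * t))) \<le> 2 / \<mu> i"
        using norm_integral_cis_le[OF ab, of "- \<mu> i"] mu[of i] by simp
      also have "\<dots> \<le> 2 / \<mu> 0"
        using mu[of 0] mu[of i] main_freq_mono[of N "N + i"]
        by (intro divide_left_mono) (auto simp: \<mu>_def)
      finally show "norm (integral {d..2 * d} (\<lambda>t. cis (- \<mu> i * t))) \<le> E"
        using muE E0 by linarith
      have "norm (integral {d..2 * d} (\<lambda>t. ?e t * \<psi> t)) \<le> (1 / 2 ^ N * 3) * (2 * d - d)"
      proof (intro integral_bound ab continuous_on_mult cont_e cont_\<psi>)
        fix t assume t: "t \<in> {d..2 * d}"
        have "norm (?e t) \<le> 2 ^ (N + i) * t / 2"
          unfolding \<mu>_def using t d by (intro norm_block_minus_cis_le) auto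
        also have "\<dots> \<le> 2 ^ (N + N) * (2 * d) / 2"
          using t d i by (intro divide_right_mono mult_mono power_increasing) auto
        also have "\<dots> = (2 * 2) ^ N / (2 * 2 * 2) ^ N"
          by (simp add: d_def power_add power_mult_distrib[symmetric])
        also have "\<dots> = 1 / 2 ^ N"
          unfolding power_mult_distrib[of "2 * 2" 2] by simp
        finally show "norm (?e t * \<psi> t) \<le> 1 / 2 ^ N * 3"
          unfolding norm_mult by (intro mult_mono norm_\<psi>) auto
      qed
      then show "norm (integral {d..2 * d} (\<lambda>t. ?e t * \<psi> t)) \<le> 3 * d / 2 ^ N" by simp
    qed
    finally show ?thesis by (simp add: algebra_simps)
  qed
  have freq_tail: "4 * (\<Sum>i<N. \<mu> i) \<le> main_freq (N + N + i)" "64 ^ i * \<mu> 0 \<le> main_freq (N + N + i)" for i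
  proof -
    show "4 * (\<Sum>i<N. \<mu> i) \<le> main_freq (N + N + i)"
      using lac[of N] main_freq_mono[of "N + N" "N + N + i"] unfolding \<mu>_def by simp
    have "main_freq (N + i) \<le> main_freq (N + N + i)" by (rule main_freq_mono) simp
    then show "64 ^ i * \<mu> 0 \<le> main_freq (N + N + i)" by (simp add: \<mu>_def main_freq_add)
  qed
  have high: "norm (integral {d..2 * d} (\<lambda>t. cis (- block_freq k l * t))) \<le> 2 / main_freq k"
    if "l \<le> 2 ^ k" for k l
  proof -
    have "norm (integral {d..2 * d} (\<lambda>t. cis (- block_freq k l * t))) \<le> 2 / block_freq k l"
      using norm_integral_cis_le[OF ab, of "- block_freq k l"] block_freq_pos[of k l] by simp
    also have "\<dots> \<le> 2 / main_freq k"
      using that block_freq_bounds(1)[of l k] main_freq_pos[of k] block_freq_pos[of k l]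
      by (intro divide_left_mono) auto
    finally show ?thesis .
  qed
  \<comment> \<open>Each further block is 64 times faster, so the errors form a geometric
    series.\<close>
  have tail: "norm (J (N + N + i)) \<le> 2 * E * (1 / 64) ^ i" for i
    unfolding J_def
  proof (intro norm_block_integral_le cont_\<psi>)
    let ?k = "N + N + i"
    fix l :: nat assume l: "l \<le> 2 ^ ?k"
    have "norm (integral {d..2 * d} (\<lambda>t. cis (- block_freq ?k l * t) * \<psi> t)) \<le>
        4 * (1 + c) ^ N / main_freq ?k + 2 / main_freq ?k"
      unfolding T using l block_freq_bounds(1)[OF l] block_freq_pos[of ?k l]
      by (intro norm_triangle_le_diff[OF add_mono] high riesz_transform_high_frequency[OF ab c(1) mu]
          main_freq_pos freq_tail) auto
    also have "\<dots> \<le> 4 * (1 + c) ^ N / (64 ^ i * \<mu> 0) + 2 / (64 ^ i * \<mu> 0)"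
      using freq_tail(2)[of i] mu[of 0] c main_freq_pos[of ?k]
      by (intro add_mono divide_left_mono) auto
    also have "\<dots> = (E + 2 / \<mu> 0) * (1 / 64) ^ i"
      using mu[of 0] by (simp add: E_def field_simps)
    also have "\<dots> \<le> 2 * E * (1 / 64) ^ i"
      using muE E0 by (intro mult_right_mono) auto
    finally show "norm (integral {d..2 * d} (\<lambda>t. cis (- block_freq ?k l * t) * \<psi> t)) \<le> 2 * E * (1 / 64) ^ i" .
  qed
  have geometric: "norm (suminf g) \<le> B * 2" if "\<And>i. norm (g i) \<le> B * (1 / 64) ^ i" "0 \<le> B"
    for g :: "nat \<Rightarrow> complex" and B :: real
  proof -
    have "norm (suminf g) \<le> suminf (\<lambda>i. B * (1 / 64) ^ i)"
      by (intro norm_suminf_le that summable_mult summable_geometric) simp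
    also have "\<dots> = B * (64 / 63)"
      by (simp add: suminf_mult suminf_geometric)
    also have "\<dots> \<le> B * 2" using that(2) by (intro mult_left_mono) auto
    finally show ?thesis .
  qed

  have J_sums: "J sums integral {d..2 * d} (\<lambda>t. F t * \<psi> t)"
    unfolding J_def F_def by (rule block_series_integral_sums[OF d d1 cont_\<psi>])
  define R where "R = \<i> * of_real (c / 2 * d)"
  have "integral {d..2 * d} (\<lambda>t. F t * \<psi> t) = (\<Sum>k<N + N. J k) + suminf (\<lambda>i. J (N + N + i))"
    using J_sums suminf_split_initial_segment[of J "N + N"] by (simp add: sums_iff add.commute)
  also have "(\<Sum>k<N + N. J k) = (\<Sum>k<N. J k) + (\<Sum>i<N. J (N + i))"
  proof -
    have "(\<Sum>k<N + M. J k) = (\<Sum>k<N. J k) + (\<Sum>i<M. J (N + i))" for M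
      by (induction M) (simp_all add: add.assoc)
    then show ?thesis .
  qed
  also have "(\<Sum>i<N. J (N + i)) = N * R + (\<Sum>i<N. J (N + i) - R)"
    by (simp add: sum_subtractf)
  finally have split: "integral {d..2 * d} (\<lambda>t. F t * \<psi> t) =
      N * R + ((\<Sum>k<N. J k) + (\<Sum>i<N. J (N + i) - R) + suminf (\<lambda>i. J (N + N + i)))" by simp

  \<comment> \<open>A crude bound: 1 for each of the first 2N blocks, oscillation for the rest. The
    resulting bound for the mean grows like N, which is harmless because the integral of \<psi> is
    at most N E and N^2 E is within the budget.\<close>
  have F_int: "norm (integral {d..2 * d} F) \<le> (2 * N + 4) * d"
  proof -
    define I where "I k = integral {d..2 * d} (\<lambda>t. block k (Complex 0 t))" for k
    have "I sums integral {d..2 * d} F"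
      using block_series_integral_sums[OF d d1, of "\<lambda>_. 1"] by (simp add: I_def[abs_def] F_def[abs_def])
    then have "integral {d..2 * d} F = (\<Sum>k<N + N. I k) + suminf (\<lambda>i. I (N + N + i))"
      using suminf_split_initial_segment[of I "N + N"] by (simp add: sums_iff add.commute)
    also have "norm \<dots> \<le> (\<Sum>k<N + N. d) + E / 2 * 2"
    proof (intro norm_triangle_le[OF add_mono] sum_norm_le geometric)
      fix k
      have "norm (I k) \<le> 1 * (2 * d - d)"
        unfolding I_def
        by (intro integral_bound ab norm_block_imaginary_axis_le continuous_intros)
      then show "norm (I k) \<le> d" by simp
    next
      fix i
      have "norm (I (N + N + i)) \<le> 2 / main_freq (N + N + i)"
        unfolding I_def using norm_block_integral_le[of d "2 * d" "\<lambda>_. 1" "N + N + i"] high[where k = "N + N + i"]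
        by simp
      also have "\<dots> \<le> 2 / (64 ^ i * \<mu> 0)"
        using freq_tail(2)[of i] mu[of 0] main_freq_pos by (intro divide_left_mono) auto
      also have "\<dots> = 2 / \<mu> 0 * (1 / 64) ^ i" by (simp add: field_simps)
      also have "\<dots> \<le> E / 2 * (1 / 64) ^ i" using muE by (intro mult_right_mono) auto
      finally show "norm (I (N + N + i)) \<le> E / 2 * (1 / 64) ^ i" .
    qed (use E0 in auto)
    also have "\<dots> \<le> (2 * N + 4) * d"
      using NNE NN(2) E0 mult_right_mono[OF NN(2) E0] by (simp add: algebra_simps)
    finally show ?thesis .
  qed
  then have m: "norm m \<le> 2 * N + 4"
    using d by (simp add: m_def F_def[abs_def] norm_divide field_simps)
  have \<psi>_int: "norm (integral {d..2 * d} \<psi>) \<le> N * E"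
    using low[of 0] mu[of 0] by simp

  have "integral {d..2 * d} (\<lambda>t. (F t - m) * \<psi> t) =
      integral {d..2 * d} (\<lambda>t. F t * \<psi> t) - integral {d..2 * d} (\<lambda>t. m * \<psi> t)"
    unfolding left_diff_distrib
    by (intro Henstock_Kurzweil_Integration.integral_diff integrable_continuous_real
        continuous_on_mult cont_F cont_\<psi> continuous_on_const)
  also have "\<dots> = integral {d..2 * d} (\<lambda>t. F t * \<psi> t) - m * integral {d..2 * d} \<psi>"
    by simp
  finally have NR: "N * R = integral {d..2 * d} (\<lambda>t. (F t - m) * \<psi> t) + m * integral {d..2 * d} \<psi>
      - ((\<Sum>k<N. J k) + (\<Sum>i<N. J (N + i) - R) + suminf (\<lambda>i. J (N + N + i)))"
    using split by simp
  have "norm (integral {d..2 * d} (\<lambda>t. (F t - m) * \<psi> t)) \<le> integral {d..2 * d} (\<lambda>t. 3 * norm (F t - m))"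
  proof (rule integral_norm_bound_integral)
    show "norm ((F t - m) * \<psi> t) \<le> 3 * norm (F t - m)" for t
      using mult_left_mono[OF norm_\<psi>[of t], of "norm (F t - m)"] by (simp add: norm_mult mult.commute)
  qed (intro integrable_continuous_real continuous_intros cont_F cont_\<psi>)+
  then have main: "norm (integral {d..2 * d} (\<lambda>t. (F t - m) * \<psi> t)) \<le> 3 * X"
    by (simp add: X_def)
  have early': "norm (\<Sum>k<N. J k) \<le> (\<Sum>k<N. N * E)"
    by (intro sum_norm_le early) simp
  have middle': "norm (\<Sum>i<N. J (N + i) - R) \<le> (\<Sum>i<N. (2 * N + 3) * E + 3 * d / 2 ^ N)"
    unfolding R_def by (intro sum_norm_le middle) simp
  have tail': "norm (suminf (\<lambda>i. J (N + N + i))) \<le> 2 * E * 2"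
    using E0 by (intro geometric tail) simp
  have mean: "norm (m * integral {d..2 * d} \<psi>) \<le> (2 * N + 4) * (N * E)"
    unfolding norm_mult by (intro mult_mono m \<psi>_int) auto
  have "sqrt N / 2 * d = norm (N * R)"
    using c(4) c(1) d by (simp add: R_def norm_mult)
  also have "\<dots> \<le> (3 * X + (2 * N + 4) * (N * E)) +
      ((\<Sum>k<N. N * E) + (\<Sum>i<N. (2 * N + 3) * E + 3 * d / 2 ^ N) + 2 * E * 2)"
    unfolding NR
    by (intro norm_triangle_le[OF add_mono] norm_triangle_le_diff[OF add_mono]
        main mean early' middle' tail')
  also have "\<dots> = 3 * X + 5 * (real N * real N * E) + 7 * (real N * E) + 4 * E + 3 * d * (real N / 2 ^ N)"
    by (simp add: algebra_simps)
  \<comment> \<open>N^2 E, N E and E are all at most 4d, and N / 2^N is at most 1: (5 + 7 + 4) * 4 +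
    3 = 67.\<close>
  also have "\<dots> \<le> 3 * X + 5 * (4 * d) + 7 * (4 * d) + 4 * (4 * d) + 3 * d * 1"
    using NNE mult_right_mono[OF NN(1) E0] mult_right_mono[OF NN(2) E0] N2 d
    by (intro add_mono mult_left_mono) (auto simp: field_simps)
  finally show ?thesis
    using d by (simp add: X_def F_def)
qed

text \<open>The oscillation condition alone is contradicted, by the intervals [8^(-N), 2 * 8^(-N)].
  There the boundary function is continuous, so the Lebesgue integrals of the definitions agree with
  the gauge integrals used so far.\<close>

lemma block_series_not_BMOA: "block_series \<notin> BMOA"
proof
  assume "block_series \<in> BMOA"
  then have "(SUP (a, b)\<in>{(a, b). a < b}. mean_oscillation (boundary_value block_series) a b) < \<infinity>"
    by (simp add: BMOA_def)
  then obtain C :: real where C: "0 \<le> C"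
    "(SUP (a, b)\<in>{(a, b). a < b}. mean_oscillation (boundary_value block_series) a b) = ennreal C"
    by (cases "SUP (a, b)\<in>{(a, b). a < b}. mean_oscillation (boundary_value block_series) a b") auto
  have osc: "mean_oscillation (boundary_value block_series) a b \<le> ennreal C" if "a < b" for a b
    unfolding C(2)[symmetric] using that by (intro SUP_upper2[of "(a, b)"]) auto
  have bound: "sqrt N / 2 \<le> 67 + 3 * C" if N: "1 \<le> N" for N :: nat
  proof -
    define d :: real where "d = 1 / 8 ^ N"
    define F where "F t = block_series (Complex 0 t)" for t
    define m where "m = integral {d..2 * d} F / of_real d"
    define X where "X = integral {d..2 * d} (\<lambda>t. norm (F t - m))"
    have d: "0 < d" by (simp add: d_def)
    have "(8 :: real) ^ 1 \<le> 8 ^ N" using N by (intro power_increasing) auto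
    then have d1: "2 * d \<le> 1" by (simp add: d_def field_simps)
    have bv: "boundary_value block_series t = F t" if "t \<in> {d..2 * d}" for t
      using that d d1 by (simp add: boundary_value_block_series F_def)
    have cont: "continuous_on {d..2 * d} F"
      unfolding F_def by (rule continuous_on_block_series_imaginary[OF d d1])
    have "interval_mean (boundary_value block_series) d (2 * d) = (LINT t:{d..2 * d}|lborel. F t) /\<^sub>R d"
      unfolding interval_mean_def
      by (subst set_lebesgue_integral_cong[of "{d..2 * d}" lborel _ F]) (use bv in auto)
    also have "\<dots> = m"
      unfolding set_borel_integral_eq_integral(2)[OF borel_integrable_atLeastAtMost'[OF cont]]
      by (simp add: m_def scaleR_conv_of_real divide_inverse mult.commute)
    finally have mean: "interval_mean (boundary_value block_series) d (2 * d) = m" .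
    have cont': "continuous_on {d..2 * d} (\<lambda>t. norm (F t - m))"
      by (intro continuous_intros cont)
    have "(\<integral>\<^sup>+t\<in>{d..2 * d}. ennreal (norm (boundary_value block_series t - m)) \<partial>lborel) =
        (\<integral>\<^sup>+t. ennreal (indicator {d..2 * d} t *\<^sub>R norm (F t - m)) \<partial>lborel)"
      by (intro nn_integral_cong) (auto simp: bv split: split_indicator)
    also have "\<dots> = ennreal (LINT t:{d..2 * d}|lborel. norm (F t - m))"
      unfolding set_lebesgue_integral_def
      using borel_integrable_atLeastAtMost'[OF cont']
      by (intro nn_integral_eq_integral) (auto simp: set_integrable_def)
    also have "\<dots> = ennreal X"
      by (simp add: set_borel_integral_eq_integral(2)[OF borel_integrable_atLeastAtMost'[OF cont']] X_def)
    finally have "mean_oscillation (boundary_value block_series) d (2 * d) = ennreal X / ennreal d"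
      by (simp add: mean_oscillation_def mean)
    moreover have X0: "0 \<le> X"
      unfolding X_def by (intro Henstock_Kurzweil_Integration.integral_nonneg
          integrable_continuous_real cont') auto
    ultimately have "ennreal (X / d) \<le> ennreal C"
      using osc[of d "2 * d"] d by (simp add: divide_ennreal)
    then have "X / d \<le> C" using C(1) by simp
    then have "X \<le> C * d" using d by (simp add: field_simps)
    moreover have "sqrt N / 2 * d \<le> 67 * d + 3 * X"
      using block_series_oscillation[OF N] by (simp add: X_def m_def F_def[abs_def] d_def)
    ultimately have "sqrt N / 2 * d \<le> (67 + 3 * C) * d" by (simp add: algebra_simps)
    then show ?thesis using d by simp
  qed
  \<comment> \<open>The contradiction is taken at N = n^2, whose square root is n.\<close>
  obtain n :: nat where n: "2 * (67 + 3 * C) < n" using reals_Archimedean2 by blast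
  have "real n = sqrt (real (n * n))" by simp
  moreover have "1 \<le> n * n" using n C(1) by (cases n) auto
  ultimately show False using bound[of "n * n"] n by simp
qed

subsection \<open>The Bohr lift\<close>

lemma nth_prime_0: "nth_prime 0 = 2"
proof -
  have "(LEAST p :: nat. prime p) = 2"
    by (rule Least_equality) (auto dest: prime_ge_2_nat)
  then show ?thesis by (simp add: nth_prime_def enumerate_0)
qed

lemma nth_prime_1: "nth_prime (Suc 0) = 3"
proof -
  have "(LEAST p :: nat. prime p \<and> 2 < p) = 3"
    by (rule Least_equality) auto
  then show ?thesis
    using nth_prime_0 by (simp add: nth_prime_def enumerate_Suc''[OF primes_infinite])
qed

lemma prime_nth_prime: "prime (nth_prime j)"
  using enumerate_in_set[OF primes_infinite, of j] by (simp add: nth_prime_def)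

lemma kappa_eq_imp_eq:
  assumes "kappa m = kappa n" "0 < m" "0 < n"
  shows "m = n"
proof (rule multiplicity_eq_nat[OF assms(2,3)])
  fix p :: nat assume "prime p"
  then obtain j where "nth_prime j = p"
    using enumerate_Ex[OF primes_infinite, of p] by (auto simp: nth_prime_def)
  then show "multiplicity p m = multiplicity p n"
    using arg_cong[OF assms(1), of "\<lambda>\<alpha>. Poly_Mapping.lookup \<alpha> j"] by (simp add: kappa.rep_eq)
qed

lemma monomial_eval_kappa:
  "monomial_eval (kappa (block_number (k, l))) z = z 0 ^ l * z 1 ^ (64 ^ k)"
proof -
  let ?\<alpha> = "kappa (block_number (k, l))"
  have lookup: "Poly_Mapping.lookup ?\<alpha> j =
      (if nth_prime j = 2 then l else if nth_prime j = 3 then 64 ^ k else 0)" for j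
    using multiplicity_2_power_3_power[OF prime_nth_prime]
    by (simp add: kappa.rep_eq block_number_def)
  have inj: "nth_prime i = nth_prime j \<longleftrightarrow> i = j" for i j
    unfolding nth_prime_def using inj_enumerate[OF primes_infinite] by (auto dest: injD)
  have eq: "nth_prime j = 2 \<longleftrightarrow> j = 0" "nth_prime j = 3 \<longleftrightarrow> j = 1" for j
    using inj[of j 0] inj[of j 1] by (auto simp: nth_prime_0 nth_prime_1)
  \<comment> \<open>For l = 0 the key 0 is absent, but its exponent 0 makes the extra factor
    1.\<close>
  have "monomial_eval ?\<alpha> z = (\<Prod>j\<in>{0, 1}. z j ^ Poly_Mapping.lookup ?\<alpha> j)"
    unfolding monomial_eval_def
    by (rule prod.mono_neutral_left) (auto simp: lookup eq in_keys_iff split: if_splits)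
  then show ?thesis by (simp add: lookup eq)
qed

lemma analytic_poly_eval_superset:
  assumes "finite S" "Poly_Mapping.keys P \<subseteq> S"
  shows "analytic_poly_eval P z = (\<Sum>\<alpha>\<in>S. Poly_Mapping.lookup P \<alpha> * monomial_eval \<alpha> z)"
  unfolding analytic_poly_eval_def
  by (rule sum.mono_neutral_left) (use assms in \<open>auto simp: in_keys_iff\<close>)

lemma analytic_poly_eval_add:
  "analytic_poly_eval (P + Q) z = analytic_poly_eval P z + analytic_poly_eval Q z"
proof -
  let ?S = "Poly_Mapping.keys P \<union> Poly_Mapping.keys Q"
  have "analytic_poly_eval R z = (\<Sum>\<alpha>\<in>?S. Poly_Mapping.lookup R \<alpha> * monomial_eval \<alpha> z)"
    if "R \<in> {P, Q, P + Q}" for R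
    using that by (intro analytic_poly_eval_superset) (auto dest: Poly_Mapping.keys_add[THEN subsetD])
  then show ?thesis
    by (simp add: lookup_add distrib_right sum.distrib)
qed

lemma analytic_poly_eval_single:
  "analytic_poly_eval (Poly_Mapping.single \<alpha> c) z = c * monomial_eval \<alpha> z"
  by (simp add: analytic_poly_eval_def)

lemma analytic_poly_eval_sum:
  "analytic_poly_eval (\<Sum>j\<in>S. Poly_Mapping.single (\<alpha> j) (c j)) z = (\<Sum>j\<in>S. c j * monomial_eval (\<alpha> j) z)"
  by (induction S rule: infinite_finite_induct)
    (simp_all add: analytic_poly_eval_add analytic_poly_eval_single, simp_all add: analytic_poly_eval_def)

section \<open>Polynomial approximants of the lift\<close>

definition partial_index :: "nat \<Rightarrow> (nat \<times> nat) set" where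
  "partial_index K = (SIGMA k:{..<K}. {..2 ^ k})"

text \<open>The cut is made between blocks, because only complete blocks collapse to the power form
  that is estimated on the torus.\<close>

definition partial_poly :: "nat \<Rightarrow> analytic_poly" where
  "partial_poly K = (\<Sum>j\<in>partial_index K.
     Poly_Mapping.single (kappa (block_number j)) (of_real (case_prod block_weight j)))"

definition torus_block :: "nat \<Rightarrow> (nat \<Rightarrow> complex) \<Rightarrow> complex" where
  "torus_block k z = z 1 ^ (64 ^ k) * ((1 + z 0) / 2) ^ (2 ^ k)"

definition torus_series :: "(nat \<Rightarrow> complex) \<Rightarrow> complex" where
  "torus_series z = suminf (\<lambda>k. torus_block k z)"

lemma finite_partial_index: "finite (partial_index K)"
  by (simp add: partial_index_def)

lemma partial_poly_eval: "analytic_poly_eval (partial_poly K) z = (\<Sum>k<K. torus_block k z)"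
proof -
  have "analytic_poly_eval (partial_poly K) z =
      (\<Sum>(k, l)\<in>partial_index K. of_real (block_weight k l) * (z 0 ^ l * z 1 ^ (64 ^ k)))"
    unfolding partial_poly_def analytic_poly_eval_sum
    by (intro sum.cong refl) (auto simp: monomial_eval_kappa)
  also have "\<dots> = (\<Sum>k<K. \<Sum>l\<le>2 ^ k. of_real (block_weight k l) * (z 0 ^ l * z 1 ^ (64 ^ k)))"
    unfolding partial_index_def by (subst sum.Sigma) auto
  also have "\<dots> = (\<Sum>k<K. torus_block k z)"
    unfolding torus_block_def power_half_one_plus sum_distrib_left
    by (intro sum.cong refl) (simp add: block_weight_def algebra_simps)
  finally show ?thesis .
qed

lemma lookup_partial_poly:
  "Poly_Mapping.lookup (partial_poly K) \<alpha> =
     (\<Sum>j | j \<in> partial_index K \<and> kappa (block_number j) = \<alpha>. of_real (case_prod block_weight j))"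
proof -
  have "Poly_Mapping.lookup (partial_poly K) \<alpha> =
      (\<Sum>j\<in>partial_index K. if kappa (block_number j) = \<alpha> then of_real (case_prod block_weight j) else 0)"
    by (simp add: partial_poly_def lookup_sum lookup_single when_def)
  also have "\<dots> = (\<Sum>j | j \<in> partial_index K \<and> kappa (block_number j) = \<alpha>. of_real (case_prod block_weight j))"
    by (rule sum.inter_filter[OF finite_partial_index, symmetric])
  finally show ?thesis .
qed

text \<open>Each coefficient is eventually constant: it is final as soon as its block is included,
  and it is always 0 if no block contains it.\<close>

lemma lookup_partial_poly_tendsto:
  "(\<lambda>K. Poly_Mapping.lookup (partial_poly K) \<alpha>) \<longlonglongrightarrow> bohr_lift block_coeff \<alpha>"
proof (cases "\<exists>j\<in>block_index. kappa (block_number j) = \<alpha>")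
  case True
  then obtain k l where kl: "l \<le> 2 ^ k" "kappa (block_number (k, l)) = \<alpha>"
    by (auto simp: block_index_def)
  have "{n. 1 \<le> n \<and> kappa n = \<alpha>} = {block_number (k, l)}"
    using kl kappa_eq_imp_eq block_number_pos[of "(k, l)"] by fastforce
  then have lift: "bohr_lift block_coeff \<alpha> = of_real (block_weight k l)"
    using kl(1) by (simp add: bohr_lift_def block_coeff_number)
  have "Poly_Mapping.lookup (partial_poly K) \<alpha> = bohr_lift block_coeff \<alpha>" if "k < K" for K
  proof -
    have "{j. j \<in> partial_index K \<and> kappa (block_number j) = \<alpha>} = {(k, l)}"
    proof (intro set_eqI iffI)
      fix j assume "j \<in> {j. j \<in> partial_index K \<and> kappa (block_number j) = \<alpha>}"
      then have "block_number j = block_number (k, l)"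
        using kl(2) by (intro kappa_eq_imp_eq block_number_pos) simp
      then show "j \<in> {(k, l)}" using injD[OF inj_block_number] by blast
    qed (use that kl in \<open>auto simp: partial_index_def\<close>)
    then show ?thesis by (simp add: lookup_partial_poly lift)
  qed
  then show ?thesis
    by (intro tendsto_eventually) (auto simp: eventually_sequentially intro!: exI[of _ "Suc k"])
next
  case False
  have "block_coeff n = 0" if "kappa n = \<alpha>" for n
    using False that by (auto simp: block_coeff_def)
  then have "bohr_lift block_coeff \<alpha> = 0" by (simp add: bohr_lift_def)
  moreover have "Poly_Mapping.lookup (partial_poly K) \<alpha> = 0" for K
  proof -
    have "{j. j \<in> partial_index K \<and> kappa (block_number j) = \<alpha>} = {}"
      using False by (auto simp: partial_index_def block_index_def)
    then show ?thesis unfolding lookup_partial_poly by (metis sum.empty)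
  qed
  ultimately show ?thesis by simp
qed

text \<open>The constant is the maximum p^p exp (-p) of x^p exp (-x), attained at x = p.\<close>

lemma powr_exp_minus_le:
  fixes x p :: real
  assumes "0 < x" "0 < p"
  shows "exp (- x) \<le> exp (p * ln p - p) * x powr - p"
proof -
  have "ln (x / p) \<le> x / p - 1" using assms by (intro ln_le_minus_one) auto
  then have "p * ln (x / p) \<le> x - p" using assms by (simp add: field_simps)
  then have "- x \<le> (p * ln p - p) + - p * ln x"
    using assms by (simp add: ln_div algebra_simps)
  then show ?thesis
    using assms by (simp add: powr_def flip: exp_add)
qed

text \<open>The bound is far from sharp (the sum grows like \<open>ln (1 / (1 - w))\<close>), but any exponent \<open>p > 0\<close>
  is allowed, which is what integrability of all powers requires.\<close>
lemma lacunary_power_series_bound: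
  fixes p :: real
  assumes "0 < p"
  obtains C where "0 \<le> C" and
    "\<And>w. 0 \<le> w \<Longrightarrow> w < 1 \<Longrightarrow> summable (\<lambda>k. w ^ (2 ^ k)) \<and> suminf (\<lambda>k. w ^ (2 ^ k)) \<le> C * (1 - w) powr - p"
proof
  define r where "r = (2 :: real) powr - p"
  define A where "A = exp (p * ln p - p)"
  have r: "0 < r" "r < 1" using assms by (auto simp: r_def powr_less_one)
  show "0 \<le> A / (1 - r)" using r by (simp add: A_def)
  fix w :: real assume w: "0 \<le> w" "w < 1"
  \<comment> \<open>Since w is at most exp (-(1 - w)), the power is at most exp (-2^k (1 - w));
    trading the exponential for the power -p makes the terms geometric with ratio 2^(-p).\<close>
  have le: "w ^ (2 ^ k) \<le> A * (1 - w) powr - p * r ^ k" for k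
  proof -
    have "w \<le> exp (- (1 - w))" using exp_ge_add_one_self[of "w - 1"] by simp
    then have "w ^ (2 ^ k) \<le> exp (- (1 - w)) ^ (2 ^ k)" using w by (intro power_mono)
    also have "\<dots> = exp (- (2 ^ k * (1 - w)))" by (simp add: algebra_simps flip: exp_of_nat_mult)
    also have "\<dots> \<le> A * (2 ^ k * (1 - w)) powr - p"
      unfolding A_def using w assms by (intro powr_exp_minus_le) auto
    also have "(2 ^ k * (1 - w)) powr - p = r ^ k * (1 - w) powr - p"
      using w by (simp add: powr_mult r_def powr_power powr_powr mult.commute flip: powr_realpow)
    finally show ?thesis by (simp add: algebra_simps)
  qed
  have sum: "summable (\<lambda>k. A * (1 - w) powr - p * r ^ k)"
    using r by (intro summable_mult summable_geometric) simp
  have "summable (\<lambda>k. w ^ (2 ^ k))"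
    by (rule summable_comparison_test'[OF sum, of 0]) (use le w in auto)
  moreover from this have "suminf (\<lambda>k. w ^ (2 ^ k)) \<le> suminf (\<lambda>k. A * (1 - w) powr - p * r ^ k)"
    by (intro suminf_le le sum)
  moreover have "suminf (\<lambda>k. A * (1 - w) powr - p * r ^ k) = A / (1 - r) * (1 - w) powr - p"
    using r by (simp add: suminf_mult suminf_geometric)
  ultimately show "summable (\<lambda>k. w ^ (2 ^ k)) \<and> suminf (\<lambda>k. w ^ (2 ^ k)) \<le> A / (1 - r) * (1 - w) powr - p"
    by simp
qed

section \<open>Integrability of the singularity at z = 1 on the circle\<close>

lemma measurable_cis_circle [measurable]:
  "cis \<in> uniform_measure lborel {0..<2 * pi} \<rightarrow>\<^sub>M restrict_space borel (sphere 0 1)"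
proof (rule measurable_restrict_space2)
  have "cis \<in> borel_measurable borel"
    by (intro borel_measurable_continuous_onI continuous_intros)
  then show "cis \<in> borel_measurable (uniform_measure lborel {0..<2 * pi})"
    by (simp cong: measurable_cong_sets)
qed auto

lemma prob_space_circle_measure: "prob_space circle_measure"
  unfolding circle_measure_def
  by (intro prob_space.prob_space_distr[OF _ measurable_cis_circle] prob_space_uniform_measure) auto

lemma AE_circle_measure_neq_1: "AE z in circle_measure. z \<noteq> 1"
proof -
  have "AE \<theta> in lborel. \<theta> \<in> {0..<2 * pi} \<longrightarrow> cis \<theta> \<noteq> 1"
  proof (rule AE_mp[OF AE_lborel_singleton[of 0]], intro AE_I2 impI)
    fix \<theta> :: real assume "\<theta> \<noteq> 0" "\<theta> \<in> {0..<2 * pi}"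
    then have "0 < sin (\<theta> / 2)" by (intro sin_gt_zero) auto
    then have "cos \<theta> < 1" using cos_double_sin[of "\<theta> / 2"] by simp
    then show "cis \<theta> \<noteq> 1" by (auto simp: complex_eq_iff)
  qed
  then have "AE \<theta> in uniform_measure lborel {0..<2 * pi}. cis \<theta> \<noteq> 1"
    by (intro AE_uniform_measureI) auto
  then show ?thesis
    unfolding circle_measure_def
    by (subst AE_distr_iff) (auto simp: sets_restrict_space)
qed

text \<open>A weak form of Jordan's inequality: x^2 is at most 4 on this range, so x - x^3 / 6 is at
  least x - 2 x / 3.\<close>

lemma sin_ge_third:
  fixes x :: real
  assumes "0 \<le> x" "x \<le> pi / 2"
  shows "x / 3 \<le> sin x"
proof -
  have "\<bar>sin x - (\<Sum>m<3. sin_coeff m * x ^ m)\<bar> \<le> inverse (fact 3) * \<bar>x\<bar> ^ 3"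
    by (rule Maclaurin_sin_bound)
  then have "\<bar>sin x - x\<bar> \<le> x ^ 3 / 6"
    using assms by (simp add: numeral_3_eq_3 sin_coeff_def fact_numeral)
  then have "x - x ^ 3 / 6 \<le> sin x" by linarith
  moreover have "x ^ 3 \<le> 4 * x"
  proof -
    have "x\<^sup>2 \<le> 2\<^sup>2" using assms pi_less_4 by (intro power_mono) auto
    then have "x\<^sup>2 * x \<le> 4 * x" using assms by (intro mult_right_mono) auto
    then show ?thesis by (simp add: power3_eq_cube power2_eq_square)
  qed
  ultimately show ?thesis by simp
qed

lemma norm_half_one_plus:
  fixes z :: complex
  assumes "norm z = 1"
  shows "(norm ((1 + z) / 2))\<^sup>2 = (1 + Re z) / 2"
proof -
  have "(norm (1 + z))\<^sup>2 = 1 + 2 * Re z + (norm z)\<^sup>2"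
    by (simp add: cmod_power2) algebra
  then show ?thesis using assms by (simp add: norm_divide power_divide)
qed

lemma norm_half_one_plus_less_1:
  fixes z :: complex
  assumes "norm z = 1" "z \<noteq> 1"
  shows "norm ((1 + z) / 2) < 1"
proof -
  have "Re z \<noteq> 1" using assms by (auto simp: complex_eq_iff norm_complex_def)
  then have "Re z < 1" using complex_Re_le_cmod[of z] assms(1) by simp
  then have "(norm ((1 + z) / 2))\<^sup>2 < 1\<^sup>2" unfolding norm_half_one_plus[OF assms(1)] by simp
  then show ?thesis by (rule power2_less_imp_less) simp
qed

text \<open>With w the modulus, 1 - w^2 = sin^2 (\<theta> / 2), which vanishes quadratically at both
  ends of the period. The constant is 72 = 2 * 6^2, the 2 from 1 - w^2 being at most 2 (1 -
  w).\<close>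

lemma one_minus_norm_half_one_plus_cis_ge:
  assumes "0 \<le> \<theta>" "\<theta> \<le> 2 * pi"
  shows "(min \<theta> (2 * pi - \<theta>))\<^sup>2 / 72 \<le> 1 - norm ((1 + cis \<theta>) / 2)"
proof -
  let ?w = "norm ((1 + cis \<theta>) / 2)"
  have "min \<theta> (2 * pi - \<theta>) / 6 \<le> sin (\<theta> / 2)"
  proof (cases "\<theta> \<le> pi")
    case True
    then show ?thesis using sin_ge_third[of "\<theta> / 2"] assms by simp
  next
    case False
    have "sin (\<theta> / 2) = sin ((2 * pi - \<theta>) / 2)" by (simp add: diff_divide_distrib)
    then show ?thesis using False sin_ge_third[of "(2 * pi - \<theta>) / 2"] assms by simp
  qed
  then have "(min \<theta> (2 * pi - \<theta>) / 6)\<^sup>2 \<le> (sin (\<theta> / 2))\<^sup>2"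
    using assms by (intro power_mono) auto
  also have "\<dots> = 1 - ?w\<^sup>2"
    using cos_double_sin[of "\<theta> / 2"] unfolding norm_half_one_plus[OF norm_cis] by (simp add: field_simps)
  also have "\<dots> \<le> 2 * (1 - ?w)"
  proof -
    have "0 \<le> (1 - ?w)\<^sup>2" by simp
    then show ?thesis by (simp add: power2_eq_square algebra_simps)
  qed
  finally show ?thesis by (simp add: power_divide)
qed

lemma nn_integral_powr_finite:
  fixes a c :: real
  assumes "- 1 < a" "0 \<le> c"
  shows "(\<integral>\<^sup>+x. ennreal (x powr a) * indicator {0..c} x \<partial>lborel) < \<infinity>"
  using nn_integral_has_integral_lebesgue'[OF _ integrable_integral[OF integrable_on_powr_from_0[OF assms]]]
  by simp

lemma borel_measurable_circle_measure:
  "f \<in> borel_measurable borel \<Longrightarrow> f \<in> borel_measurable circle_measure"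
  unfolding circle_measure_def measurable_distr_eq1 by (rule measurable_restrict_space1)

text \<open>Because of the quadratic vanishing, the exponent -1/4 becomes -1/2 in the angle, which
  is integrable. The two ends of the period are handled by adding both singularities.\<close>

lemma integrable_circle_measure_singularity:
  "integrable circle_measure (\<lambda>z. (1 - norm ((1 + z) / 2)) powr - (1 / 4))"
proof (rule integrableI_bounded)
  let ?h = "\<lambda>z :: complex. (1 - norm ((1 + z) / 2)) powr - (1 / 4)"
  let ?I = "{0..2 * pi}"
  have [measurable]: "?h \<in> borel_measurable borel" by measurable
  show "?h \<in> borel_measurable circle_measure"
    by (rule borel_measurable_circle_measure) measurable
  define c :: real where "c = 72 powr (1 / 4)"
  let ?g = "\<lambda>x :: real. ennreal (x powr - (1 / 2)) * indicator ?I x"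
  have le: "ennreal (?h (cis \<theta>)) * indicator {0..<2 * pi} \<theta> \<le> ennreal c * (?g \<theta> + ?g (2 * pi - \<theta>))" for \<theta>
  proof (cases "\<theta> \<in> {0<..<2 * pi}")
    case True
    let ?m = "min \<theta> (2 * pi - \<theta>)"
    have m: "0 < ?m" using True by auto
    have "?h (cis \<theta>) \<le> (?m\<^sup>2 / 72) powr - (1 / 4)"
      using True m by (intro powr_mono2' one_minus_norm_half_one_plus_cis_ge) auto
    also have "\<dots> = c * ?m powr - (1 / 2)"
      using m by (simp add: c_def powr_divide powr_minus powr_powr field_simps flip: powr_numeral)
    also have "\<dots> \<le> c * (\<theta> powr - (1 / 2) + (2 * pi - \<theta>) powr - (1 / 2))"
      by (intro mult_left_mono) (auto simp: min_def c_def)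
    finally show ?thesis
      using True by (simp add: c_def flip: ennreal_plus ennreal_mult)
  next
    case False
    \<comment> \<open>At \<theta> = 0 the left side is 0, because
      \<open>0 powr x = 0\<close>.\<close>
    then show ?thesis by (cases "\<theta> = 0") (auto simp: indicator_def)
  qed
  have "(\<integral>\<^sup>+x. ?g (2 * pi - x) \<partial>lborel) = (\<integral>\<^sup>+x. ?g x \<partial>lborel)"
    using nn_integral_real_affine[of ?g "- 1" "2 * pi"] by simp
  then have "(\<integral>\<^sup>+x. ennreal c * (?g x + ?g (2 * pi - x)) \<partial>lborel) =
      ennreal c * ((\<integral>\<^sup>+x. ?g x \<partial>lborel) + (\<integral>\<^sup>+x. ?g x \<partial>lborel))"
    by (simp add: nn_integral_cmult nn_integral_add)
  also have "\<dots> < \<infinity>"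
    using nn_integral_powr_finite[of "- (1 / 2)" "2 * pi"] by (simp add: ennreal_mult_less_top)
  finally have "(\<integral>\<^sup>+\<theta>. ennreal (?h (cis \<theta>)) * indicator {0..<2 * pi} \<theta> \<partial>lborel) < \<infinity>"
    by (rule le_less_trans[OF nn_integral_mono[OF le]])
  moreover have "(\<integral>\<^sup>+z. ennreal (norm (?h z)) \<partial>circle_measure) =
      (\<integral>\<^sup>+\<theta>. ennreal (?h (cis \<theta>)) * indicator {0..<2 * pi} \<theta> \<partial>lborel) / emeasure lborel {0..<2 * pi}"
  proof -
    have "(\<integral>\<^sup>+z. ennreal (norm (?h z)) \<partial>circle_measure) =
        (\<integral>\<^sup>+\<theta>. ennreal (?h (cis \<theta>)) \<partial>uniform_measure lborel {0..<2 * pi})"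
      unfolding circle_measure_def
      by (subst nn_integral_distr) (auto intro!: measurable_restrict_space1)
    also have "\<dots> = (\<integral>\<^sup>+\<theta>. ennreal (?h (cis \<theta>)) * indicator {0..<2 * pi} \<theta> \<partial>lborel) / emeasure lborel {0..<2 * pi}"
    proof (rule nn_integral_uniform_measure)
      have [measurable]: "cis \<in> borel_measurable borel"
        by (intro borel_measurable_continuous_onI continuous_intros)
      show "(\<lambda>\<theta>. ennreal (?h (cis \<theta>))) \<in> borel_measurable lborel" by measurable
    qed simp
    finally show ?thesis .
  qed
  ultimately show "(\<integral>\<^sup>+z. ennreal (norm (?h z)) \<partial>circle_measure) < \<infinity>"
    by (auto simp: ennreal_divide_eq_top_iff simp flip: less_top)
qed

section \<open>Transfer to the polytorus and membership in every H^q\<close>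

lemma measurable_polytorus_component [measurable]: "(\<lambda>z. z j) \<in> borel_measurable polytorus"
proof -
  have "(\<lambda>z. z j) \<in> polytorus \<rightarrow>\<^sub>M circle_measure"
    unfolding polytorus_def by (rule measurable_component_singleton) simp
  then show ?thesis
    by (rule measurable_compose) (rule borel_measurable_circle_measure, simp)
qed

lemma torus_coordinate_norm: "z \<in> space polytorus \<Longrightarrow> norm (z j) = 1"
  by (auto simp: polytorus_def space_PiM circle_measure_def space_restrict_space PiE_def Pi_def)

lemma integrable_polytorus_component:
  fixes f :: "complex \<Rightarrow> real"
  assumes "integrable circle_measure f"
  shows "integrable polytorus (\<lambda>z. f (z j))"
proof -
  have "distr polytorus circle_measure (\<lambda>z. z j) = circle_measure"
    unfolding polytorus_def by (rule distr_PiM_component) (auto intro: prob_space_circle_measure)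
  then show ?thesis
    using assms unfolding polytorus_def
    by (metis UNIV_I integrable_distr measurable_component_singleton)
qed

lemma AE_polytorus_neq_1: "AE z in polytorus. z j \<noteq> 1"
  unfolding polytorus_def
  by (rule AE_PiM_component) (auto intro: prob_space_circle_measure AE_circle_measure_neq_1)

text \<open>On the torus the powers of z_1 have modulus 1, so only the one-variable sum of |(1 +
  z_0) / 2|^(2^k) has to be controlled. It dominates all remainders at once, and dominated
  convergence does the rest.\<close>

lemma block_coeff_Hq_dirichlet:
  assumes q: "0 < q"
  shows "block_coeff \<in> Hq_dirichlet q"
proof -
  \<comment> \<open>With this exponent the q-th power of the bound has the singularity of order 1/4
    shown to be integrable.\<close>
  have "0 < 1 / (4 * q)" using q by simp
  then obtain C where C: "0 \<le> C" "\<And>w. 0 \<le> w \<Longrightarrow> w < 1 \<Longrightarrow> summable (\<lambda>k. w ^ (2 ^ k)) \<and>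
      suminf (\<lambda>k. w ^ (2 ^ k)) \<le> C * (1 - w) powr - (1 / (4 * q))"
    by (rule lacunary_power_series_bound) blast
  define H where "H z = C powr q * (1 - norm ((1 + z 0) / 2)) powr - (1 / 4)" for z :: "nat \<Rightarrow> complex"
  have int_H: "integrable polytorus H"
    unfolding H_def
    by (intro integrable_mult_right integrable_polytorus_component[OF integrable_circle_measure_singularity])
  have meas_block [measurable]: "torus_block k \<in> borel_measurable polytorus" for k
    unfolding torus_block_def by measurable
  have meas [measurable]: "torus_series \<in> borel_measurable polytorus"
    unfolding torus_series_def[abs_def] by measurable
  \<comment> \<open>The case K = 0 is the modulus of \<open>torus_series\<close> itself, so the same
    domination also gives membership in L^q.\<close>
  define r where "r K z = norm ((\<Sum>k<K. torus_block k z) - torus_series z)" for K z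
  have good: "r K z powr q \<le> H z \<and> (\<lambda>K. r K z) \<longlonglongrightarrow> 0" if z: "z \<in> space polytorus" "z 0 \<noteq> 1" for K z
  proof -
    let ?w = "norm ((1 + z 0) / 2)"
    have w: "0 \<le> ?w" "?w < 1"
      using norm_half_one_plus_less_1[of "z 0"] torus_coordinate_norm[OF z(1), of 0] z(2) by auto
    have norm_block: "norm (torus_block k z) = ?w ^ (2 ^ k)" for k
      using torus_coordinate_norm[OF z(1), of 1] by (simp add: torus_block_def norm_mult norm_power)
    have sw: "summable (\<lambda>k. ?w ^ (2 ^ k))" using C(2)[OF w] by blast
    then have sn: "summable (\<lambda>k. norm (torus_block k z))" by (simp only: norm_block)
    then have s: "summable (\<lambda>k. torus_block k z)" by (rule summable_norm_cancel)
    have "(\<lambda>K. \<Sum>k<K. torus_block k z) \<longlonglongrightarrow> torus_series z"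
      unfolding torus_series_def using s by (rule summable_LIMSEQ)
    then have lim: "(\<lambda>K. r K z) \<longlonglongrightarrow> 0"
      unfolding r_def by (intro tendsto_norm_zero LIM_zero)
    have "torus_series z = suminf (\<lambda>k. torus_block (k + K) z) + (\<Sum>k<K. torus_block k z)"
      unfolding torus_series_def by (rule suminf_split_initial_segment[OF s])
    then have "r K z = norm (suminf (\<lambda>k. torus_block (k + K) z))"
      by (simp add: r_def norm_minus_commute)
    also have "\<dots> \<le> suminf (\<lambda>k. norm (torus_block (k + K) z))"
      by (intro summable_norm summable_ignore_initial_segment sn)
    also have "\<dots> \<le> suminf (\<lambda>k. norm (torus_block k z))"
      using suminf_split_initial_segment[OF sn, of K] by (simp add: sum_nonneg)
    also have "\<dots> \<le> C * (1 - ?w) powr - (1 / (4 * q))"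
      using C(2)[OF w] by (simp only: norm_block)
    finally have "r K z powr q \<le> (C * (1 - ?w) powr - (1 / (4 * q))) powr q"
      using q by (intro powr_mono2) (auto simp: r_def)
    also have "\<dots> = H z"
      using C(1) w q by (simp add: H_def powr_mult powr_powr)
    finally show ?thesis using lim by blast
  qed
  have AE_good: "AE z in polytorus. z 0 \<noteq> 1" by (rule AE_polytorus_neq_1)
  have r0: "r 0 z = norm (torus_series z)" for z by (simp add: r_def)
  have "integrable polytorus (\<lambda>z. norm (torus_series z) powr q)"
  proof (rule Bochner_Integration.integrable_bound[OF int_H])
    show "AE z in polytorus. norm (norm (torus_series z) powr q) \<le> norm (H z)"
      using AE_good by (rule AE_mp) (use good[of _ 0] in \<open>force intro!: AE_I2 simp: r0\<close>)
  qed measurable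
  then have Lq: "torus_series \<in> Lq_torus q"
    by (simp add: Lq_torus_def)
  have "(\<lambda>K. LINT z|polytorus. r K z powr q) \<longlonglongrightarrow> (LINT z|polytorus. 0)"
  proof (rule integral_dominated_convergence[OF _ _ int_H])
    show "(\<lambda>z. r K z powr q) \<in> borel_measurable polytorus" for K
      unfolding r_def by measurable
    show "AE z in polytorus. (\<lambda>K. r K z powr q) \<longlonglongrightarrow> 0"
      using AE_good
    proof (rule AE_mp, intro AE_I2 impI)
      fix z assume "z \<in> space polytorus" "z 0 \<noteq> 1"
      then have "(\<lambda>K. r K z) \<longlonglongrightarrow> 0" using good by blast
      then show "(\<lambda>K. r K z powr q) \<longlonglongrightarrow> 0"
        using q tendsto_powr'[of "\<lambda>K. r K z" 0 sequentially "\<lambda>_. q" q] by (simp add: r_def)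
    qed
    show "AE z in polytorus. norm (r K z powr q) \<le> H z" for K
      using AE_good by (rule AE_mp) (use good in \<open>auto intro!: AE_I2\<close>)
  qed simp
  then have "tendsto_Lq q partial_poly torus_series"
    by (simp add: tendsto_Lq_def partial_poly_eval r_def)
  then show ?thesis
    using Lq lookup_partial_poly_tendsto
    by (auto simp: Hq_dirichlet_def Hq_torus_def has_torus_coeffs_def)
qed

theorem corollary3p5:
  "\<exists>(f :: complex \<Rightarrow> complex) (a :: nat \<Rightarrow> complex).
     has_dirichlet_series f a \<and>
     f \<in> Bloch \<and>
     a \<in> (\<Inter>q\<in>{q :: real. 0 < q}. Hq_dirichlet q) \<and>
     f \<notin> BMOA"
  using block_series_has_dirichlet_series block_series_Bloch block_coeff_Hq_dirichlet
    block_series_not_BMOA by blast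

end
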